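(* Let $\mathbf C$ be a cubical $\omega$-category, and fix $n>0$. The following five properties are equivalent: (1) Any $n$-cell in $\mathbf C_n$ is invertible. (2) For all $1\le i\le n$, any $n$-cell in $\mathbf C_n$ with an $R_i$-invertible shell is $R_i$-invertible. (3) Any $n$-cell in $\mathbf C_n$ with an $R_1$-invertible shell is $R_1$-invertible. (4) Any $n$-cell $A\in\mathbf C_n$ such that for all $j\ne1$ and $\alpha=\pm$, $\partial_j^\alpha A$ lies in the image of $\epsilon_1$, is $R_1$-invertible. (5) Any $n$-cell in $\Phi_n(\mathbf C_n)$ is $R_1$-invertible. Moreover, if $n>1$, then all the previous properties are also equivalent to each of the following: (6) For all $1\le i<n$, any $n$-cell in $\mathbf C_n$ with a $T_i$-invertible shell is $T_i$-invertible. (7) Any $n$-cell in $\mathbf C_n$ with a $T_1$-invertible shell is $T_1$-invertible.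
   Context: Index notation: for positive integers $i,j$, $j^i=j$ if $j<i$ and $j^i=j+1$ if $j\ge i$; for $j\neq i$, $j_i=j$ if $j<i$ and $j_i=j-1$ if $j>i$. Cubical $\omega$-categories (always with connections): a cubical $\omega$-category $\mathbf C$ consists of sets $\mathbf C_n$ ($n\ge0$), maps $\partial_i^\alpha:\mathbf C_n\to\mathbf C_{n-1}$ and $\Gamma_i^\alpha:\mathbf C_n\to\mathbf C_{n+1}$ ($n\ge1$, $1\le i\le n$, $\alpha=\pm$), maps $\epsilon_i:\mathbf C_n\to\mathbf C_{n+1}$ ($n\ge0$, $1\le i\le n+1$), and partial operations $\star_i$ on $\mathbf C_n$ ($1\le i\le n$), with $A\star_iB$ defined exactly when $\partial_i^+A=\partial_i^-B$, subject to (for all indices and cells for which both sides make sense): - $\partial_{j-1}^\alpha\partial_i^\beta=\partial_i^\beta\partial_j^\alpha$ for $i<j$; - $\partial_i^\alpha\epsilon_j=\epsilon_{j_i}\partial_{i_j}^\alpha$ for $i\ne j$, and $\partial_i^\alpha\epsilon_i=\mathrm{id}$; - $\partial_i^\alpha\Gamma_j^\beta=\Gamma_{j_i}^\beta\partial_{i_j}^\alpha$ for $i\ne j,j+1$; for $i\in\{j,j+1\}$, $\partial_i^\alpha\Gamma_j^\alpha=\mathrm{id}$ and $\partial_i^\alpha\Gamma_j^{-\alpha}=\epsilon_j\partial_j^\alpha$; - $\epsilon_i\epsilon_j=\epsilon_{j+1}\epsilon_i$ for $i\le j$; $\Gamma_i^\alpha\Gamma_j^\beta=\Gamma_{j+1}^\beta\Gamma_i^\alpha$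 for $i<j$; $\Gamma_{i+1}^\alpha\Gamma_i^\alpha=\Gamma_i^\alpha\Gamma_i^\alpha$; $\Gamma_i^\alpha\epsilon_j=\epsilon_{j^i}\Gamma_{i_j}^\alpha$ for $i\ne j$; $\Gamma_i^\alpha\epsilon_i=\epsilon_i\epsilon_i$; - $\partial_i^\alpha(A\star_jB)=\partial_i^\alpha A\star_{j_i}\partial_i^\alpha B$ for $i\neq j$; $\partial_i^-(A\star_iB)=\partial_i^-A$; $\partial_i^+(A\star_iB)=\partial_i^+B$; - $\star_i$ is associative; $A\star_i\epsilon_i\partial_i^+A=\epsilon_i\partial_i^-A\star_iA=A$; $(A\star_iB)\star_j(C\star_iD)=(A\star_jC)\star_i(B\star_jD)$ for $i\neq j$; - $\epsilon_i(A\star_jB)=\epsilon_iA\star_{j^i}\epsilon_iB$; $\Gamma_i^\alpha(A\star_jB)=\Gamma_i^\alpha A\star_{j^i}\Gamma_i^\alpha B$ for $i\ne j$; $\Gamma_i^-(A\star_iB)=(\Gamma_i^-A\star_i\epsilon_{i+1}B)\star_{i+1}(\epsilon_iB\star_i\Gamma_i^-B)$; $\Gamma_i^+(A\star_iB)=(\Gamma_i^+A\star_i\epsilon_iA)\star_{i+1}(\epsilon_{i+1}A\star_i\Gamma_i^+B)$; - $\Gamma_i^+A\star_i\Gamma_i^-A=\epsilon_{i+1}A$; $\Gamma_i^+A\star_{i+1}\Gamma_i^-A=\epsilon_iA$. A cubical $n$-category is the same structure restricted to dimensions $\le n$; $\mathrm{tr}_n\mathbf C$ denotes the truncation of $\mathbf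 C$ to dimensions $\le n$. $R_k$-invertibility. $A\in\mathbf C_n$ is $R_k$-invertible ($1\le k\le n$) if there is $B\in\mathbf C_n$ with $A\star_kB=\epsilon_k\partial_k^-A$ and $B\star_kA=\epsilon_k\partial_k^+A$. Folding operations and plain invertibility. For $1\le i\le n-1$ put $\psi_iA=\Gamma_i^+\partial_{i+1}^-A\star_{i+1}A\star_{i+1}\Gamma_i^-\partial_{i+1}^+A$ on $\mathbf C_n$; put $\Psi_r=\psi_{r-1}\cdots\psi_1$ ($1\le r\le n$) and $\Phi_n=\Psi_1\cdots\Psi_n$. A cell $A\in\mathbf C_n$ ($n\ge1$) is invertible if $\psi_1\cdots\psi_{n-1}A$ is $R_1$-invertible. $T_i$-invertibility. For $1\le i<n$, $A\in\mathbf C_n$ is $T_i$-invertible with $T_i$-inverse $B\in\mathbf C_n$ if $\partial_i^\alpha A=\partial_{i+1}^\alpha B$ and $\partial_{i+1}^\alpha A=\partial_i^\alpha B$ for $\alpha=\pm$, and $(\Gamma_i^+\partial_{i+1}^-A\star_iB)\star_{i+1}(A\star_i\Gamma_i^-\partial_i^+A)=\Gamma_i^-\partial_i^-A\star_i\Gamma_i^+\partial_{i+1}^+A$, together with the same equation with $A$ and $B$ exchanged. Shells. For a cubical $n$-category $\mathbf C$, $\Box\mathbf C$ is the cubical $(n+1)$-category equal to $\mathbf C$ in dimensions $\le n$, whose $(n+1)$-cells are the families $A=(A_i^\alpha)_{1\le i\le n+1,\alpha=\pm}$ of $n$-cells with $\partial_{i_j}^\alpha A_j^\beta=\partial_{j_i}^\beta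 A_i^\alpha$ for $i\ne j$, with $\partial_i^\alpha A=A_i^\alpha$; for $A\in\mathbf C_n$, $\epsilon_iA$ and $\Gamma_i^\alpha A$ in dimension $n+1$ are the families of faces prescribed by the axioms above; $(A\star_iB)_i^-=A_i^-$, $(A\star_iB)_i^+=B_i^+$, $(A\star_iB)_j^\alpha=A_j^\alpha\star_{i_j}B_j^\alpha$ for $j\neq i$. For a cubical $\omega$-category $\mathbf C$ and $A\in\mathbf C_n$ ($n\ge1$), the shell of $A$ is $\boldsymbol\partial A=(\partial_i^\alpha A)$, an $n$-cell of $\Box\,\mathrm{tr}_{n-1}\mathbf C$; $A$ has an $R_k$-invertible (resp. $T_i$-invertible) shell if $\boldsymbol\partial A$ is $R_k$-invertible (resp. $T_i$-invertible) in $\Box\,\mathrm{tr}_{n-1}\mathbf C$. *)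

theory Defs
  imports Main "HOL-Library.FuncSet"
begin

section \<open>Indices and signs\<close>

text \<open>\<open>j \<up> i\<close> and \<open>j \<down> i\<close> are the indices usually written $j^i$ and $j_i$;
  the latter is only used for $j \neq i$.\<close>

definition idx_up :: "nat \<Rightarrow> nat \<Rightarrow> nat" (infixl "\<up>" 70)
  where "j \<up> i = (if j < i then j else j + 1)"

definition idx_down :: "nat \<Rightarrow> nat \<Rightarrow> nat" (infixl "\<down>" 70)
  where "j \<down> i = (if j < i then j else j - 1)"

datatype sign = Neg | Pos

fun opp :: "sign \<Rightarrow> sign" where
  "opp Neg = Pos"
| "opp Pos = Neg"


section \<open>Cubical \<open>\<omega>\<close>-categories with connections\<close>

text \<open>The cells of all dimensions are taken from one type, but the sets \<open>cells C n\<close> need not be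
  disjoint. Hence each operation takes the dimension \<open>n\<close> of its arguments: for \<open>A \<in> C\<^sub>n\<close>,
  \<open>face C n i \<alpha> A \<in> C\<^sub>n\<^sub>-\<^sub>1\<close>, \<open>conn C n i \<alpha> A \<in> C\<^sub>n\<^sub>+\<^sub>1\<close>, \<open>degen C n i A \<in> C\<^sub>n\<^sub>+\<^sub>1\<close>, and
  \<open>star C n i\<close> is the composition of \<open>n\<close>-cells in direction \<open>i\<close>. The values of these functions
  outside their intended domains (in particular \<open>star\<close> on pairs that are not \<open>composable\<close>)
  are unconstrained.\<close>

record 'a cubical =
  cells :: "nat \<Rightarrow> 'a set"
  face  :: "nat \<Rightarrow> nat \<Rightarrow> sign \<Rightarrow> 'a \<Rightarrow> 'a"
  conn  :: "nat \<Rightarrow> nat \<Rightarrow> sign \<Rightarrow> 'a \<Rightarrow> 'a"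
  degen :: "nat \<Rightarrow> nat \<Rightarrow> 'a \<Rightarrow> 'a"
  star  :: "nat \<Rightarrow> nat \<Rightarrow> 'a \<Rightarrow> 'a \<Rightarrow> 'a"

definition composable :: "'a cubical \<Rightarrow> nat \<Rightarrow> nat \<Rightarrow> 'a \<Rightarrow> 'a \<Rightarrow> bool"
  where "composable C n i A B \<longleftrightarrow> face C n i Pos A = face C n i Neg B"

locale cubical_omega_category =
  fixes C :: "'a cubical"
  assumes face_closed:
      "\<lbrakk>1 \<le> i; i \<le> n; A \<in> cells C n\<rbrakk> \<Longrightarrow> face C n i \<alpha> A \<in> cells C (n - 1)"
    and conn_closed:
      "\<lbrakk>1 \<le> i; i \<le> n; A \<in> cells C n\<rbrakk> \<Longrightarrow> conn C n i \<alpha> A \<in> cells C (n + 1)"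
    and degen_closed:
      "\<lbrakk>1 \<le> i; i \<le> n + 1; A \<in> cells C n\<rbrakk> \<Longrightarrow> degen C n i A \<in> cells C (n + 1)"
    and star_closed:
      "\<lbrakk>1 \<le> i; i \<le> n; A \<in> cells C n; B \<in> cells C n; composable C n i A B\<rbrakk>
        \<Longrightarrow> star C n i A B \<in> cells C n"

    and face_face:
      "\<lbrakk>1 \<le> i; i < j; j \<le> n; A \<in> cells C n\<rbrakk>
        \<Longrightarrow> face C (n - 1) (j - 1) \<alpha> (face C n i \<beta> A) = face C (n - 1) i \<beta> (face C n j \<alpha> A)"

    and face_degen_neq:
      "\<lbrakk>1 \<le> i; i \<le> n + 1; 1 \<le> j; j \<le> n + 1; i \<noteq> j; A \<in> cells C n\<rbrakk>
        \<Longrightarrow> face C (n + 1) i \<alpha> (degen C n j A) = degen C (n - 1) (j \<down> i) (face C n (i \<down> j) \<alpha> A)"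
    and face_degen_eq:
      "\<lbrakk>1 \<le> i; i \<le> n + 1; A \<in> cells C n\<rbrakk> \<Longrightarrow> face C (n + 1) i \<alpha> (degen C n i A) = A"

    and face_conn_neq:
      "\<lbrakk>1 \<le> i; i \<le> n + 1; 1 \<le> j; j \<le> n; i \<noteq> j; i \<noteq> j + 1; A \<in> cells C n\<rbrakk>
        \<Longrightarrow> face C (n + 1) i \<alpha> (conn C n j \<beta> A)
              = conn C (n - 1) (j \<down> i) \<beta> (face C n (i \<down> j) \<alpha> A)"
    and face_conn_same:
      "\<lbrakk>1 \<le> j; j \<le> n; i \<in> {j, j + 1}; A \<in> cells C n\<rbrakk>
        \<Longrightarrow> face C (n + 1) i \<alpha> (conn C n j \<alpha> A) = A"
    and face_conn_opp:
      "\<lbrakk>1 \<le> j; j \<le> n; i \<in> {j, j + 1}; A \<in> cells C n\<rbrakk>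
        \<Longrightarrow> face C (n + 1) i \<alpha> (conn C n j (opp \<alpha>) A) = degen C (n - 1) j (face C n j \<alpha> A)"

    and degen_degen:
      "\<lbrakk>1 \<le> i; i \<le> j; j \<le> n + 1; A \<in> cells C n\<rbrakk>
        \<Longrightarrow> degen C (n + 1) i (degen C n j A) = degen C (n + 1) (j + 1) (degen C n i A)"
    and conn_conn_less:
      "\<lbrakk>1 \<le> i; i < j; j \<le> n; A \<in> cells C n\<rbrakk>
        \<Longrightarrow> conn C (n + 1) i \<alpha> (conn C n j \<beta> A) = conn C (n + 1) (j + 1) \<beta> (conn C n i \<alpha> A)"
    and conn_conn_same:
      "\<lbrakk>1 \<le> i; i \<le> n; A \<in> cells C n\<rbrakk>
        \<Longrightarrow> conn C (n + 1) (i + 1) \<alpha> (conn C n i \<alpha> A) = conn C (n + 1) i \<alpha> (conn C n i \<alpha> A)"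
    and conn_degen_neq:
      "\<lbrakk>1 \<le> i; i \<le> n + 1; 1 \<le> j; j \<le> n + 1; i \<noteq> j; A \<in> cells C n\<rbrakk>
        \<Longrightarrow> conn C (n + 1) i \<alpha> (degen C n j A) = degen C (n + 1) (j \<up> i) (conn C n (i \<down> j) \<alpha> A)"
    and conn_degen_eq:
      "\<lbrakk>1 \<le> i; i \<le> n + 1; A \<in> cells C n\<rbrakk>
        \<Longrightarrow> conn C (n + 1) i \<alpha> (degen C n i A) = degen C (n + 1) i (degen C n i A)"

    and face_star_neq:
      "\<lbrakk>1 \<le> i; i \<le> n; 1 \<le> j; j \<le> n; i \<noteq> j; A \<in> cells C n; B \<in> cells C n; composable C n j A B\<rbrakk>
        \<Longrightarrow> face C n i \<alpha> (star C n j A B)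
              = star C (n - 1) (j \<down> i) (face C n i \<alpha> A) (face C n i \<alpha> B)"
    and face_star_Neg:
      "\<lbrakk>1 \<le> i; i \<le> n; A \<in> cells C n; B \<in> cells C n; composable C n i A B\<rbrakk>
        \<Longrightarrow> face C n i Neg (star C n i A B) = face C n i Neg A"
    and face_star_Pos:
      "\<lbrakk>1 \<le> i; i \<le> n; A \<in> cells C n; B \<in> cells C n; composable C n i A B\<rbrakk>
        \<Longrightarrow> face C n i Pos (star C n i A B) = face C n i Pos B"

    and star_assoc:
      "\<lbrakk>1 \<le> i; i \<le> n; A \<in> cells C n; B \<in> cells C n; D \<in> cells C n;
        composable C n i A B; composable C n i B D\<rbrakk>
        \<Longrightarrow> star C n i (star C n i A B) D = star C n i A (star C n i B D)"
    and star_unit_right: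
      "\<lbrakk>1 \<le> i; i \<le> n; A \<in> cells C n\<rbrakk>
        \<Longrightarrow> star C n i A (degen C (n - 1) i (face C n i Pos A)) = A"
    and star_unit_left:
      "\<lbrakk>1 \<le> i; i \<le> n; A \<in> cells C n\<rbrakk>
        \<Longrightarrow> star C n i (degen C (n - 1) i (face C n i Neg A)) A = A"
    and star_interchange:
      "\<lbrakk>1 \<le> i; i \<le> n; 1 \<le> j; j \<le> n; i \<noteq> j;
        A \<in> cells C n; B \<in> cells C n; D \<in> cells C n; E \<in> cells C n;
        composable C n i A B; composable C n i D E; composable C n j A D; composable C n j B E\<rbrakk>
        \<Longrightarrow> star C n j (star C n i A B) (star C n i D E)
              = star C n i (star C n j A D) (star C n j B E)"

    and degen_star:
      "\<lbrakk>1 \<le> i; i \<le> n + 1; 1 \<le> j; j \<le> n; A \<in> cells C n; B \<in> cells C n; composable C n j A B\<rbrakk>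
        \<Longrightarrow> degen C n i (star C n j A B) = star C (n + 1) (j \<up> i) (degen C n i A) (degen C n i B)"
    and conn_star_neq:
      "\<lbrakk>1 \<le> i; i \<le> n; 1 \<le> j; j \<le> n; i \<noteq> j; A \<in> cells C n; B \<in> cells C n; composable C n j A B\<rbrakk>
        \<Longrightarrow> conn C n i \<alpha> (star C n j A B)
              = star C (n + 1) (j \<up> i) (conn C n i \<alpha> A) (conn C n i \<alpha> B)"
    and conn_Neg_star:
      "\<lbrakk>1 \<le> i; i \<le> n; A \<in> cells C n; B \<in> cells C n; composable C n i A B\<rbrakk>
        \<Longrightarrow> conn C n i Neg (star C n i A B)
              = star C (n + 1) (i + 1)
                  (star C (n + 1) i (conn C n i Neg A) (degen C n (i + 1) B))
                  (star C (n + 1) i (degen C n i B) (conn C n i Neg B))"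
    and conn_Pos_star:
      "\<lbrakk>1 \<le> i; i \<le> n; A \<in> cells C n; B \<in> cells C n; composable C n i A B\<rbrakk>
        \<Longrightarrow> conn C n i Pos (star C n i A B)
              = star C (n + 1) (i + 1)
                  (star C (n + 1) i (conn C n i Pos A) (degen C n i A))
                  (star C (n + 1) i (degen C n (i + 1) A) (conn C n i Pos B))"

    and conn_star_conn:
      "\<lbrakk>1 \<le> i; i \<le> n; A \<in> cells C n\<rbrakk>
        \<Longrightarrow> star C (n + 1) i (conn C n i Pos A) (conn C n i Neg A) = degen C n (i + 1) A"
    and conn_star_Suc_conn:
      "\<lbrakk>1 \<le> i; i \<le> n; A \<in> cells C n\<rbrakk>
        \<Longrightarrow> star C (n + 1) (i + 1) (conn C n i Pos A) (conn C n i Neg A) = degen C n i A"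


section \<open>Invertibility\<close>

text \<open>The invertibility notions are defined for an arbitrary structure, because they are used both
  in a cubical \<open>\<omega>\<close>-category and in the shell category built from one of its truncations.\<close>

definition R_invertible :: "'a cubical \<Rightarrow> nat \<Rightarrow> nat \<Rightarrow> 'a \<Rightarrow> bool"
  where "R_invertible C n k A \<longleftrightarrow>
    (\<exists>B \<in> cells C n.
      composable C n k A B \<and> star C n k A B = degen C (n - 1) k (face C n k Neg A) \<and>
      composable C n k B A \<and> star C n k B A = degen C (n - 1) k (face C n k Pos A))"

definition psi :: "'a cubical \<Rightarrow> nat \<Rightarrow> nat \<Rightarrow> 'a \<Rightarrow> 'a"
  where "psi C n i A =
    star C n (i + 1)
      (star C n (i + 1) (conn C (n - 1) i Pos (face C n (i + 1) Neg A)) A)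
      (conn C (n - 1) i Neg (face C n (i + 1) Pos A))"

text \<open>\<open>fold\<close> applies the operation with the first list entry first and \<open>foldr\<close> applies it last:
  \<open>Psi C n r\<close> is $\psi_{r-1} \cdots \psi_1$, \<open>Phi C n\<close> is $\Psi_1 \cdots \Psi_n$, and \<open>invertible\<close>
  refers to $\psi_1 \cdots \psi_{n-1} A$.\<close>

definition Psi :: "'a cubical \<Rightarrow> nat \<Rightarrow> nat \<Rightarrow> 'a \<Rightarrow> 'a"
  where "Psi C n r A = fold (psi C n) [1..<r] A"

definition Phi :: "'a cubical \<Rightarrow> nat \<Rightarrow> 'a \<Rightarrow> 'a"
  where "Phi C n A = foldr (Psi C n) [1..<n + 1] A"

definition invertible :: "'a cubical \<Rightarrow> nat \<Rightarrow> 'a \<Rightarrow> bool"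
  where "invertible C n A \<longleftrightarrow> R_invertible C n 1 (foldr (psi C n) [1..<n] A)"

text \<open>The face conditions make every composite in the two equations composable, so no further
  composability conditions are needed.\<close>

definition T_equation :: "'a cubical \<Rightarrow> nat \<Rightarrow> nat \<Rightarrow> 'a \<Rightarrow> 'a \<Rightarrow> bool"
  where "T_equation C n i A B \<longleftrightarrow>
    star C n (i + 1)
      (star C n i (conn C (n - 1) i Pos (face C n (i + 1) Neg A)) B)
      (star C n i A (conn C (n - 1) i Neg (face C n i Pos A)))
    = star C n i
        (conn C (n - 1) i Neg (face C n i Neg A))
        (conn C (n - 1) i Pos (face C n (i + 1) Pos A))"

definition T_inverse :: "'a cubical \<Rightarrow> nat \<Rightarrow> nat \<Rightarrow> 'a \<Rightarrow> 'a \<Rightarrow> bool"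
  where "T_inverse C n i A B \<longleftrightarrow>
    (\<forall>\<alpha>. face C n i \<alpha> A = face C n (i + 1) \<alpha> B \<and> face C n (i + 1) \<alpha> A = face C n i \<alpha> B) \<and>
    T_equation C n i A B \<and> T_equation C n i B A"

definition T_invertible :: "'a cubical \<Rightarrow> nat \<Rightarrow> nat \<Rightarrow> 'a \<Rightarrow> bool"
  where "T_invertible C n i A \<longleftrightarrow> (\<exists>B \<in> cells C n. T_inverse C n i A B)"


section \<open>Shells\<close>

definition trunc :: "nat \<Rightarrow> 'a cubical \<Rightarrow> 'a cubical"
  where "trunc n C = C\<lparr>cells := (\<lambda>m. if m \<le> n then cells C m else {})\<rparr>"

datatype 'a box_cell = Cell 'a | Shell "nat \<times> sign \<Rightarrow> 'a"

abbreviation shell_index :: "nat \<Rightarrow> (nat \<times> sign) set"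
  where "shell_index n \<equiv> {1..n} \<times> UNIV"

text \<open>Families are extensional (\<open>undefined\<close> off the index set), so that equal faces imply equal
  shells.\<close>

definition shells :: "nat \<Rightarrow> 'a cubical \<Rightarrow> (nat \<times> sign \<Rightarrow> 'a) set"
  where "shells n C =
    {S \<in> shell_index (n + 1) \<rightarrow>\<^sub>E cells C n.
      \<forall>i \<in> {1..n + 1}. \<forall>j \<in> {1..n + 1}. \<forall>\<alpha> \<beta>. i \<noteq> j \<longrightarrow>
        face C n (i \<down> j) \<alpha> (S (j, \<beta>)) = face C n (j \<down> i) \<beta> (S (i, \<alpha>))}"

definition degen_shell :: "nat \<Rightarrow> 'a cubical \<Rightarrow> nat \<Rightarrow> 'a \<Rightarrow> nat \<times> sign \<Rightarrow> 'a"
  where "degen_shell n C i A = restrict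
    (\<lambda>(j, \<alpha>). if j = i then A else degen C (n - 1) (i \<down> j) (face C n (j \<down> i) \<alpha> A))
    (shell_index (n + 1))"

definition conn_shell :: "nat \<Rightarrow> 'a cubical \<Rightarrow> nat \<Rightarrow> sign \<Rightarrow> 'a \<Rightarrow> nat \<times> sign \<Rightarrow> 'a"
  where "conn_shell n C i \<beta> A = restrict
    (\<lambda>(j, \<alpha>).
      if j \<in> {i, i + 1}
      then (if \<alpha> = \<beta> then A else degen C (n - 1) i (face C n i \<alpha> A))
      else conn C (n - 1) (i \<down> j) \<beta> (face C n (j \<down> i) \<alpha> A))
    (shell_index (n + 1))"

definition star_shell ::
    "nat \<Rightarrow> 'a cubical \<Rightarrow> nat \<Rightarrow> (nat \<times> sign \<Rightarrow> 'a) \<Rightarrow> (nat \<times> sign \<Rightarrow> 'a) \<Rightarrow> nat \<times> sign \<Rightarrow> 'a"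
  where "star_shell n C i S T = restrict
    (\<lambda>(j, \<alpha>).
      if j = i
      then (case \<alpha> of Neg \<Rightarrow> S (i, Neg) | Pos \<Rightarrow> T (i, Pos))
      else star C n (i \<down> j) (S (j, \<alpha>)) (T (j, \<alpha>)))
    (shell_index (n + 1))"

text \<open>For a cubical \<open>n\<close>-category \<open>C\<close>, \<open>box n C\<close> is the cubical \<open>(n + 1)\<close>-category $\Box C$.
  A \<open>Cell\<close> of dimension at most \<open>n\<close> is a cell of \<open>C\<close>, and a \<open>Shell\<close> always has dimension
  \<open>n + 1\<close>; the \<open>undefined\<close> branches are never reached from cells of the right dimensions.\<close>

definition box :: "nat \<Rightarrow> 'a cubical \<Rightarrow> 'a box_cell cubical"
  where "box n C = \<lparr>
    cells = (\<lambda>m. if m \<le> n then Cell ` cells C m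
                 else if m = n + 1 then Shell ` shells n C else {}),
    face = (\<lambda>m i \<alpha> x. case x of
              Cell A \<Rightarrow> Cell (face C m i \<alpha> A)
            | Shell S \<Rightarrow> Cell (S (i, \<alpha>))),
    conn = (\<lambda>m i \<alpha> x. case x of
              Cell A \<Rightarrow> if m < n then Cell (conn C m i \<alpha> A) else Shell (conn_shell n C i \<alpha> A)
            | Shell S \<Rightarrow> undefined),
    degen = (\<lambda>m i x. case x of
              Cell A \<Rightarrow> if m < n then Cell (degen C m i A) else Shell (degen_shell n C i A)
            | Shell S \<Rightarrow> undefined),
    star = (\<lambda>m i x y. case (x, y) of
              (Cell A, Cell B) \<Rightarrow> Cell (star C m i A B)
            | (Shell S, Shell T) \<Rightarrow> Shell (star_shell n C i S T)
            | _ \<Rightarrow> undefined)\<rparr>"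

definition shell :: "'a cubical \<Rightarrow> nat \<Rightarrow> 'a \<Rightarrow> 'a box_cell"
  where "shell C n A = Shell (restrict (\<lambda>(i, \<alpha>). face C n i \<alpha> A) (shell_index n))"

definition has_R_invertible_shell :: "'a cubical \<Rightarrow> nat \<Rightarrow> nat \<Rightarrow> 'a \<Rightarrow> bool"
  where "has_R_invertible_shell C n k A \<longleftrightarrow>
    R_invertible (box (n - 1) (trunc (n - 1) C)) n k (shell C n A)"

definition has_T_invertible_shell :: "'a cubical \<Rightarrow> nat \<Rightarrow> nat \<Rightarrow> 'a \<Rightarrow> bool"
  where "has_T_invertible_shell C n i A \<longleftrightarrow>
    T_invertible (box (n - 1) (trunc (n - 1) C)) n i (shell C n A)"

end

theory Submission imports Defs
begin

text \<open>The directions \<open>i\<close> and \<open>i + 1\<close> of \<open>C\<^sub>n\<close> form a double category with connections, in which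
  \<open>\<psi>\<^sub>i\<close> identifies the squares with a given boundary \<open>f, h, a, b\<close> with the globular cells
  \<open>f b \<rightarrow> a h\<close>. Through this bijection, a \<open>T\<^sub>i\<close>-inverse of \<open>A\<close> is a \<open>\<star>\<^sub>i\<close>-inverse of \<open>\<psi>\<^sub>i A\<close>, and an
  \<open>R\<^sub>i\<close>- or \<open>R\<^sub>i\<^sub>+\<^sub>1\<close>-inverse of \<open>A\<close> is a \<open>\<star>\<^sub>i\<close>-inverse of \<open>\<psi>\<^sub>i A\<close> whiskered by inverses of two opposite
  faces of \<open>A\<close>. Hence, among cells whose faces transverse to direction \<open>1\<close> are \<open>R\<^sub>1\<close>-invertible, all
  \<open>\<psi>\<^sub>j\<close> preserve this condition and reflect \<open>R\<^sub>1\<close>-invertibility, so (1) and (5) each imply (3); passing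
  from \<open>A\<close> to \<open>\<psi>\<^sub>i A\<close> lowers the direction from \<open>i + 1\<close> to \<open>i\<close> and gives (2), and likewise (2) gives (6).
  Conversely, the cells \<open>\<psi>\<^sub>1 \<dots> \<psi>\<^sub>n\<^sub>-\<^sub>1 A\<close> and \<open>\<Phi>\<^sub>n A\<close> have all faces transverse to direction \<open>1\<close> in the
  image of \<open>\<epsilon>\<^sub>1\<close>, and for such cells the inverse shells required in (3) and (7) can be written
  down.\<close>

section \<open>Double categories with connections\<close>

text \<open>For squares, \<open>d1 Neg\<close>, \<open>d1 Pos\<close>, \<open>d2 Neg\<close>, \<open>d2 Pos\<close> are the top, bottom, left and right edges;
  \<open>\<ominus>\<close> puts its first argument on top of the second and \<open>\<odot>\<close> puts it to the left.\<close>

locale double_cat =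
  fixes Sq :: "'a set" and Ar :: "'b set" and Ob :: "'c set"
    and d :: "sign \<Rightarrow> 'b \<Rightarrow> 'c" and d1 d2 :: "sign \<Rightarrow> 'a \<Rightarrow> 'b"
    and u :: "'c \<Rightarrow> 'b" and m :: "'b \<Rightarrow> 'b \<Rightarrow> 'b" (infixl "\<cdot>" 75)
    and e1 e2 :: "'b \<Rightarrow> 'a" and g :: "sign \<Rightarrow> 'b \<Rightarrow> 'a"
    and c1 :: "'a \<Rightarrow> 'a \<Rightarrow> 'a" (infixl "\<ominus>" 70)
    and c2 :: "'a \<Rightarrow> 'a \<Rightarrow> 'a" (infixl "\<odot>" 72)
  assumes d_in [simp]: "f \<in> Ar \<Longrightarrow> d \<alpha> f \<in> Ob"
    and u_in [simp]: "x \<in> Ob \<Longrightarrow> u x \<in> Ar"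
    and m_in [simp]: "\<lbrakk>f \<in> Ar; h \<in> Ar; d Pos f = d Neg h\<rbrakk> \<Longrightarrow> f \<cdot> h \<in> Ar"
    and d_u [simp]: "x \<in> Ob \<Longrightarrow> d \<alpha> (u x) = x"
    and d_m [simp]: "\<lbrakk>f \<in> Ar; h \<in> Ar; d Pos f = d Neg h\<rbrakk> \<Longrightarrow> d Neg (f \<cdot> h) = d Neg f"
      "\<lbrakk>f \<in> Ar; h \<in> Ar; d Pos f = d Neg h\<rbrakk> \<Longrightarrow> d Pos (f \<cdot> h) = d Pos h"
    and m_assoc: "\<lbrakk>f \<in> Ar; h \<in> Ar; k \<in> Ar; d Pos f = d Neg h; d Pos h = d Neg k\<rbrakk>
      \<Longrightarrow> f \<cdot> h \<cdot> k = f \<cdot> (h \<cdot> k)"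
    and m_unit [simp]: "f \<in> Ar \<Longrightarrow> f \<cdot> u (d Pos f) = f" "f \<in> Ar \<Longrightarrow> u (d Neg f) \<cdot> f = f"
    and d1_in [simp]: "A \<in> Sq \<Longrightarrow> d1 \<alpha> A \<in> Ar"
    and d2_in [simp]: "A \<in> Sq \<Longrightarrow> d2 \<alpha> A \<in> Ar"
    and e1_in [simp]: "f \<in> Ar \<Longrightarrow> e1 f \<in> Sq"
    and e2_in [simp]: "f \<in> Ar \<Longrightarrow> e2 f \<in> Sq"
    and g_in [simp]: "f \<in> Ar \<Longrightarrow> g \<alpha> f \<in> Sq"
    and c1_in [simp]: "\<lbrakk>A \<in> Sq; B \<in> Sq; d1 Pos A = d1 Neg B\<rbrakk> \<Longrightarrow> A \<ominus> B \<in> Sq"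
    and c2_in [simp]: "\<lbrakk>A \<in> Sq; B \<in> Sq; d2 Pos A = d2 Neg B\<rbrakk> \<Longrightarrow> A \<odot> B \<in> Sq"
    and d_d1: "A \<in> Sq \<Longrightarrow> d \<alpha> (d1 \<beta> A) = d \<beta> (d2 \<alpha> A)"
    and d_e1 [simp]: "f \<in> Ar \<Longrightarrow> d1 \<alpha> (e1 f) = f" "f \<in> Ar \<Longrightarrow> d2 \<alpha> (e1 f) = u (d \<alpha> f)"
    and d_e2 [simp]: "f \<in> Ar \<Longrightarrow> d1 \<alpha> (e2 f) = u (d \<alpha> f)" "f \<in> Ar \<Longrightarrow> d2 \<alpha> (e2 f) = f"
    and d_g [simp]:
      "f \<in> Ar \<Longrightarrow> d1 \<alpha> (g \<beta> f) = (if \<alpha> = \<beta> then f else u (d \<alpha> f))"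
      "f \<in> Ar \<Longrightarrow> d2 \<alpha> (g \<beta> f) = (if \<alpha> = \<beta> then f else u (d \<alpha> f))"
    and e2_u [simp]: "x \<in> Ob \<Longrightarrow> e2 (u x) = e1 (u x)"
    and g_u [simp]: "x \<in> Ob \<Longrightarrow> g \<alpha> (u x) = e1 (u x)"
    and d_c1 [simp]:
      "\<lbrakk>A \<in> Sq; B \<in> Sq; d1 Pos A = d1 Neg B\<rbrakk> \<Longrightarrow> d1 Neg (A \<ominus> B) = d1 Neg A"
      "\<lbrakk>A \<in> Sq; B \<in> Sq; d1 Pos A = d1 Neg B\<rbrakk> \<Longrightarrow> d1 Pos (A \<ominus> B) = d1 Pos B"
      "\<lbrakk>A \<in> Sq; B \<in> Sq; d1 Pos A = d1 Neg B\<rbrakk> \<Longrightarrow> d2 \<alpha> (A \<ominus> B) = d2 \<alpha> A \<cdot> d2 \<alpha> B"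
    and d_c2 [simp]:
      "\<lbrakk>A \<in> Sq; B \<in> Sq; d2 Pos A = d2 Neg B\<rbrakk> \<Longrightarrow> d2 Neg (A \<odot> B) = d2 Neg A"
      "\<lbrakk>A \<in> Sq; B \<in> Sq; d2 Pos A = d2 Neg B\<rbrakk> \<Longrightarrow> d2 Pos (A \<odot> B) = d2 Pos B"
      "\<lbrakk>A \<in> Sq; B \<in> Sq; d2 Pos A = d2 Neg B\<rbrakk> \<Longrightarrow> d1 \<alpha> (A \<odot> B) = d1 \<alpha> A \<cdot> d1 \<alpha> B"
    and c1_assoc: "\<lbrakk>A \<in> Sq; B \<in> Sq; D \<in> Sq; d1 Pos A = d1 Neg B; d1 Pos B = d1 Neg D\<rbrakk>
      \<Longrightarrow> A \<ominus> B \<ominus> D = A \<ominus> (B \<ominus> D)"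
    and c2_assoc: "\<lbrakk>A \<in> Sq; B \<in> Sq; D \<in> Sq; d2 Pos A = d2 Neg B; d2 Pos B = d2 Neg D\<rbrakk>
      \<Longrightarrow> A \<odot> B \<odot> D = A \<odot> (B \<odot> D)"
    and c1_unit: "A \<in> Sq \<Longrightarrow> A \<ominus> e1 (d1 Pos A) = A" "A \<in> Sq \<Longrightarrow> e1 (d1 Neg A) \<ominus> A = A"
    and c2_unit: "A \<in> Sq \<Longrightarrow> A \<odot> e2 (d2 Pos A) = A" "A \<in> Sq \<Longrightarrow> e2 (d2 Neg A) \<odot> A = A"
    and interchange: "\<lbrakk>A \<in> Sq; B \<in> Sq; D \<in> Sq; E \<in> Sq; d1 Pos A = d1 Neg B;
        d1 Pos D = d1 Neg E; d2 Pos A = d2 Neg D; d2 Pos B = d2 Neg E\<rbrakk>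
      \<Longrightarrow> (A \<ominus> B) \<odot> (D \<ominus> E) = (A \<odot> D) \<ominus> (B \<odot> E)"
    and e1_m: "\<lbrakk>f \<in> Ar; h \<in> Ar; d Pos f = d Neg h\<rbrakk> \<Longrightarrow> e1 (f \<cdot> h) = e1 f \<odot> e1 h"
    and g_Neg_m: "\<lbrakk>f \<in> Ar; h \<in> Ar; d Pos f = d Neg h\<rbrakk>
      \<Longrightarrow> g Neg (f \<cdot> h) = (g Neg f \<ominus> e2 h) \<odot> (e1 h \<ominus> g Neg h)"
    and g_Pos_m: "\<lbrakk>f \<in> Ar; h \<in> Ar; d Pos f = d Neg h\<rbrakk>
      \<Longrightarrow> g Pos (f \<cdot> h) = (g Pos f \<ominus> e1 f) \<odot> (e2 f \<ominus> g Pos h)"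
    and g_c1_g: "f \<in> Ar \<Longrightarrow> g Pos f \<ominus> g Neg f = e2 f"
    and g_c2_g: "f \<in> Ar \<Longrightarrow> g Pos f \<odot> g Neg f = e1 f"
begin

text \<open>Here and in the unit laws for squares below, the boundary is a variable constrained by a
  premise, so that the simplifier can also apply the law when the edge of the unit is not displayed
  as \<open>d Neg f\<close> or \<open>d1 Neg A\<close>.\<close>

lemma m_unit_left [simp]: "f \<in> Ar \<Longrightarrow> d Neg f = x \<Longrightarrow> u x \<cdot> f = f"
  by auto

lemma m_unit_right [simp]: "f \<in> Ar \<Longrightarrow> d Pos f = x \<Longrightarrow> f \<cdot> u x = f"
  by auto

lemma c1_units [simp]: "A \<in> Sq \<Longrightarrow> d1 Neg A = f \<Longrightarrow> e1 f \<ominus> A = A"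
  "A \<in> Sq \<Longrightarrow> d1 Pos A = f \<Longrightarrow> A \<ominus> e1 f = A"
  using c1_unit by auto

lemma c2_units [simp]: "A \<in> Sq \<Longrightarrow> d2 Neg A = f \<Longrightarrow> e2 f \<odot> A = A"
  "A \<in> Sq \<Longrightarrow> d2 Pos A = f \<Longrightarrow> A \<odot> e2 f = A"
  using c2_unit by auto

text \<open>\<open>e2_u\<close> rewrites \<open>e2 (u x)\<close> to \<open>e1 (u x)\<close>, so the
  units of \<open>\<odot>\<close> on degenerate edges have to be available in that normal form as
  well.\<close>

lemma c2_units_u [simp]:
  assumes "A \<in> Sq" "x \<in> Ob" shows "d2 Neg A = u x \<Longrightarrow> e1 (u x) \<odot> A = A"
  "d2 Pos A = u x \<Longrightarrow> A \<odot> e1 (u x) = A"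
  using c2_units[of A "u x"] assms by auto

text \<open>\<open>globe\<close> is the abstract form of \<open>\<psi>\<^sub>i\<close>; \<open>unglobe f h a b\<close> is its inverse on squares with boundary
  \<open>f, h, a, b\<close> (top, bottom, left, right).\<close>

definition globe :: "'a \<Rightarrow> 'a"
  where "globe A = g Pos (d2 Neg A) \<odot> A \<odot> g Neg (d2 Pos A)"

definition unglobe :: "'b \<Rightarrow> 'b \<Rightarrow> 'b \<Rightarrow> 'b \<Rightarrow> 'a \<Rightarrow> 'a"
  where "unglobe f h a b U = (e1 f \<odot> g Pos b) \<ominus> U \<ominus> (g Neg a \<odot> e1 h)"

lemma globe_faces [simp]:
  assumes "A \<in> Sq"
  shows "globe A \<in> Sq" "d1 Neg (globe A) = d1 Neg A \<cdot> d2 Pos A" "d1 Pos (globe A) = d2 Neg A \<cdot> d1 Pos A"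
    "d2 \<alpha> (globe A) = u (d \<alpha> (d1 \<alpha> A))"
  using assms unfolding globe_def by (cases \<alpha>; simp add: d_d1)+

text \<open>Degeneracies and connections all fold to identity globes (this lemma and the next two),
  so in the globe of a composite they contribute only identities.\<close>

lemma globe_e1 [simp]: "f \<in> Ar \<Longrightarrow> globe (e1 f) = e1 f"
  by (simp add: globe_def)

lemma globe_e2 [simp]: "f \<in> Ar \<Longrightarrow> globe (e2 f) = e1 f"
  by (simp add: globe_def g_c2_g)

lemma globe_g [simp]: "f \<in> Ar \<Longrightarrow> globe (g \<alpha> f) = e1 f"
  by (cases \<alpha>; simp add: globe_def g_c2_g)

lemma interchange3:
  assumes "A \<in> Sq" "A' \<in> Sq" "A'' \<in> Sq" "B \<in> Sq" "B' \<in> Sq" "B'' \<in> Sq"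
    "d2 Pos A = d2 Neg A'" "d2 Pos A' = d2 Neg A''" "d2 Pos B = d2 Neg B'" "d2 Pos B' = d2 Neg B''"
    "d1 Pos A = d1 Neg B" "d1 Pos A' = d1 Neg B'" "d1 Pos A'' = d1 Neg B''"
  shows "(A \<odot> A' \<odot> A'') \<ominus> (B \<odot> B' \<odot> B'') = (A \<ominus> B) \<odot> (A' \<ominus> B') \<odot> (A'' \<ominus> B'')"
  using assms by (simp add: interchange)

text \<open>After padding with identities, the three rows of \<open>unglobe\<close> form a 3x3 grid.
  Read by columns, the connections cancel vertically by \<open>g_c1_g\<close> to \<open>e2 a\<close>
  and \<open>e2 b\<close>, and only \<open>A\<close> remains between them.\<close>

lemma unglobe_globe:
  assumes A: "A \<in> Sq"
  shows "unglobe (d1 Neg A) (d1 Pos A) (d2 Neg A) (d2 Pos A) (globe A) = A"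
proof -
  define f h a b where "f = d1 Neg A" and "h = d1 Pos A" and "a = d2 Neg A" and "b = d2 Pos A"
  note defs = f_def h_def a_def b_def
  let ?i = "e1 (u (d Neg a))" and ?j = "e1 (u (d Pos b))"
  have "(e1 f \<odot> g Pos b) = ?i \<odot> e1 f \<odot> g Pos b"
    using A by (simp add: defs d_d1)
  moreover have "(?i \<odot> e1 f \<odot> g Pos b) \<ominus> globe A = (?i \<ominus> g Pos a) \<odot> (e1 f \<ominus> A) \<odot> (g Pos b \<ominus> g Neg b)"
    unfolding globe_def defs using A by (intro interchange3) (auto simp: d_d1)
  moreover have "\<dots> = g Pos a \<odot> A \<odot> e2 b"
    using A by (simp add: defs d_d1 g_c1_g)
  moreover have "g Neg a \<odot> e1 h = g Neg a \<odot> e1 h \<odot> ?j"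
    using A by (simp add: defs d_d1)
  moreover have "(g Pos a \<odot> A \<odot> e2 b) \<ominus> (g Neg a \<odot> e1 h \<odot> ?j)
     = (g Pos a \<ominus> g Neg a) \<odot> (A \<ominus> e1 h) \<odot> (e2 b \<ominus> ?j)"
    unfolding defs using A by (intro interchange3) (auto simp: d_d1)
  moreover have "\<dots> = A"
    using A by (simp add: defs d_d1 g_c1_g)
  ultimately show ?thesis unfolding unglobe_def defs by simp
qed

text \<open>Since \<open>unglobe\<close> needs only the globe and the boundary, equations between
  squares with equal boundaries can be proved by folding both sides.\<close>

lemma globe_inj:
  assumes "A \<in> Sq" "B \<in> Sq" "globe A = globe B" "\<And>\<alpha>. d1 \<alpha> A = d1 \<alpha> B" "\<And>\<alpha>. d2 \<alpha> A = d2 \<alpha> B"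
  shows "A = B"
  using unglobe_globe[OF assms(1)] unglobe_globe[OF assms(2)] unfolding assms(3-5) by (rule trans[OF sym])

lemma unglobe_faces:
  assumes "f \<in> Ar" "h \<in> Ar" "a \<in> Ar" "b \<in> Ar" "d Neg f = d Neg a" "d Pos f = d Neg b"
    "d Pos a = d Neg h" "d Pos h = d Pos b"
    and U: "U \<in> Sq" "d1 Neg U = f \<cdot> b" "d1 Pos U = a \<cdot> h"
      "d2 Neg U = u (d Neg f)" "d2 Pos U = u (d Pos h)"
  shows "unglobe f h a b U \<in> Sq" "d1 Neg (unglobe f h a b U) = f" "d1 Pos (unglobe f h a b U) = h"
    "d2 Neg (unglobe f h a b U) = a" "d2 Pos (unglobe f h a b U) = b"
  unfolding unglobe_def using assms by simp_all

text \<open>The counterpart of \<open>unglobe_globe\<close> with the directions exchanged: now the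
  connections meet horizontally, \<open>g_c2_g\<close> makes the outer rows
  \<open>e1 (f \<cdot> b)\<close> and \<open>e1 (a \<cdot> h)\<close>, and the middle row is
  \<open>U\<close>.\<close>

lemma globe_un:
  assumes ar: "f \<in> Ar" "h \<in> Ar" "a \<in> Ar" "b \<in> Ar" "d Neg f = d Neg a" "d Pos f = d Neg b"
    "d Pos a = d Neg h" "d Pos h = d Pos b"
    and U: "U \<in> Sq" "d1 Neg U = f \<cdot> b" "d1 Pos U = a \<cdot> h"
      "d2 Neg U = u (d Neg f)" "d2 Pos U = u (d Pos h)"
  shows "globe (unglobe f h a b U) = U"
proof -
  let ?i = "e1 (u (d Neg a))" and ?j = "e1 (u (d Pos b))"
  let ?X = "e1 f \<odot> g Pos b" and ?Y = "g Neg a \<odot> e1 h"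
  have "globe (unglobe f h a b U) = g Pos a \<odot> (?X \<ominus> U \<ominus> ?Y) \<odot> g Neg b"
    unfolding globe_def unglobe_faces[OF assms] by (simp add: unglobe_def)
  also have "\<dots> = (?i \<ominus> ?i \<ominus> g Pos a) \<odot> (?X \<ominus> U \<ominus> ?Y) \<odot> (g Neg b \<ominus> ?j \<ominus> ?j)"
    using assms by simp
  \<comment> \<open>The unit laws are switched off because they would erase the padding before the
    interchange law can use it.\<close>
  also have "\<dots> = ((?i \<odot> ?X) \<ominus> (?i \<odot> U) \<ominus> (g Pos a \<odot> ?Y)) \<odot> (g Neg b \<ominus> ?j \<ominus> ?j)"
    using assms by (simp add: interchange del: c1_units c2_units_u)
  also have "\<dots> = (?i \<odot> ?X \<odot> g Neg b) \<ominus> (?i \<odot> U \<odot> ?j) \<ominus> (g Pos a \<odot> ?Y \<odot> ?j)"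
    using assms by (simp add: interchange del: c1_units c2_units_u)
  also have "\<dots> = (?X \<odot> g Neg b) \<ominus> U \<ominus> (g Pos a \<odot> ?Y)"
    using assms by simp
  also have "?X \<odot> g Neg b = e1 (f \<cdot> b)"
    using assms by (simp add: c2_assoc g_c2_g e1_m)
  also have "g Pos a \<odot> ?Y = e1 (a \<cdot> h)"
    using assms by (simp add: c2_assoc[symmetric] g_c2_g e1_m)
  finally show ?thesis using assms by simp
qed

section \<open>Folding of composite squares\<close>

lemma g_Pos_m':
  assumes "f \<in> Ar" "h \<in> Ar" "d Pos f = d Neg h"
  shows "g Pos (f \<cdot> h) = g Pos f \<ominus> (e1 f \<odot> g Pos h)"
  \<comment> \<open>The 2x2 grid of the axiom is regrouped by rows, so that its corner
    \<open>e2 f\<close> is absorbed as a unit.\<close>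
  using assms by (simp add: g_Pos_m interchange del: c1_units)

lemma g_Neg_m':
  assumes "f \<in> Ar" "h \<in> Ar" "d Pos f = d Neg h"
  shows "g Neg (f \<cdot> h) = (g Neg f \<odot> e1 h) \<ominus> g Neg h"
  using assms by (simp add: g_Neg_m interchange del: c1_units)

text \<open>The connections on the composite edges split into one row along \<open>A\<close> and one
  along \<open>B\<close>. The two rows of the resulting grid are the globes of \<open>A\<close> and
  \<open>B\<close>, whiskered by the lower right and the upper left edge.\<close>

lemma globe_c1:
  assumes A: "A \<in> Sq" and B: "B \<in> Sq" and AB: "d1 Pos A = d1 Neg B"
  shows "globe (A \<ominus> B) = (globe A \<odot> e1 (d2 Pos B)) \<ominus> (e1 (d2 Neg A) \<odot> globe B)"
proof -
  define a b a' b' where "a = d2 Neg A" and "b = d2 Pos A" and "a' = d2 Neg B" and "b' = d2 Pos B"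
  note defs = a_def b_def a'_def b'_def
  have c: "d Pos a = d Neg a'" "d Pos b = d Neg b'"
    using d_d1[OF A] d_d1[OF B] AB by (metis defs)+
  have in_ar: "a \<in> Ar" "a' \<in> Ar" "b \<in> Ar" "b' \<in> Ar" using A B by (auto simp: defs)
  have f: "d2 Neg A = a" "d2 Pos A = b" "d2 Neg B = a'" "d2 Pos B = b'" by (simp_all add: defs)
  note s = A B AB c in_ar f
  have "globe (A \<ominus> B) = (g Pos a \<ominus> (e1 a \<odot> g Pos a')) \<odot> (A \<ominus> B) \<odot> ((g Neg b \<odot> e1 b') \<ominus> g Neg b')"
    using s by (simp add: globe_def g_Pos_m' g_Neg_m')
  also have "\<dots> = (g Pos a \<odot> A \<odot> (g Neg b \<odot> e1 b')) \<ominus> ((e1 a \<odot> g Pos a') \<odot> B \<odot> g Neg b')"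
    using s by (intro interchange3[symmetric]) auto
  also have "g Pos a \<odot> A \<odot> (g Neg b \<odot> e1 b') = globe A \<odot> e1 b'"
    using s by (simp add: globe_def c2_assoc)
  also have "(e1 a \<odot> g Pos a') \<odot> B \<odot> g Neg b' = e1 a \<odot> globe B"
    using s by (simp add: globe_def c2_assoc)
  finally show ?thesis by (simp add: defs)
qed

text \<open>The common edge \<open>b\<close> is inserted as
  \<open>e2 b = g Pos b \<ominus> g Neg b\<close>: the upper half folds \<open>B\<close>, the lower
  half folds \<open>A\<close>. Hence \<open>B\<close> lies in the first row although it is the
  second argument.\<close>

lemma globe_c2:
  assumes A: "A \<in> Sq" and B: "B \<in> Sq" and AB: "d2 Pos A = d2 Neg B"
  shows "globe (A \<odot> B) = (e1 (d1 Neg A) \<odot> globe B) \<ominus> (globe A \<odot> e1 (d1 Pos B))"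
proof -
  define a b c f f' h h' where "a = d2 Neg A" and "b = d2 Neg B" and "c = d2 Pos B"
    and "f = d1 Neg A" and "f' = d1 Neg B" and "h = d1 Pos A" and "h' = d1 Pos B"
  note defs = a_def b_def c_def f_def f'_def h_def h'_def
  have fc: "d2 Neg A = a" "d2 Pos A = b" "d2 Neg B = b" "d2 Pos B = c"
    "d1 Neg A = f" "d1 Pos A = h" "d1 Neg B = f'" "d1 Pos B = h'" using AB by (simp_all add: defs)
  have c: "d Neg f = d Neg a" "d Pos f = d Neg b" "d Neg f' = d Neg b" "d Pos f' = d Neg c"
     "d Neg h = d Pos a" "d Pos h = d Pos b" "d Neg h' = d Pos b" "d Pos h' = d Pos c"
    using d_d1[OF A] d_d1[OF B] AB by (metis defs)+
  have in_ar: "a \<in> Ar" "b \<in> Ar" "c \<in> Ar" "f \<in> Ar" "h \<in> Ar" "f' \<in> Ar" "h' \<in> Ar"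
    using A B by (auto simp: defs)
  note s = A B c in_ar fc
  let ?i = "e1 (u (d Neg a))" and ?j = "e1 (u (d Pos c))"
  have "globe (A \<odot> B) = g Pos a \<odot> A \<odot> e2 b \<odot> B \<odot> g Neg c"
    using s by (simp add: globe_def c2_assoc)
  also have "\<dots> = g Pos a \<odot> A \<odot> e2 b \<odot> (B \<odot> g Neg c)"
    using s by (simp add: c2_assoc)
  also have "\<dots> = ((?i \<ominus> g Pos a) \<odot> (e1 f \<ominus> A) \<odot> (g Pos b \<ominus> g Neg b)) \<odot> ((B \<ominus> e1 h') \<odot> (g Neg c \<ominus> ?j))"
    using s by (simp add: g_c1_g)
  also have "(?i \<ominus> g Pos a) \<odot> (e1 f \<ominus> A) \<odot> (g Pos b \<ominus> g Neg b)
     = (?i \<odot> e1 f \<odot> g Pos b) \<ominus> (g Pos a \<odot> A \<odot> g Neg b)"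
    using s by (intro interchange3[symmetric]) auto
  also have "(B \<ominus> e1 h') \<odot> (g Neg c \<ominus> ?j) = (B \<odot> g Neg c) \<ominus> (e1 h' \<odot> ?j)"
    using s by (intro interchange) auto
  also have "((?i \<odot> e1 f \<odot> g Pos b) \<ominus> (g Pos a \<odot> A \<odot> g Neg b)) \<odot> ((B \<odot> g Neg c) \<ominus> (e1 h' \<odot> ?j))
     = ((?i \<odot> e1 f \<odot> g Pos b) \<odot> (B \<odot> g Neg c)) \<ominus> ((g Pos a \<odot> A \<odot> g Neg b) \<odot> (e1 h' \<odot> ?j))"
    using s by (intro interchange) auto
  also have "(?i \<odot> e1 f \<odot> g Pos b) \<odot> (B \<odot> g Neg c) = e1 f \<odot> globe B"
    using s by (simp add: globe_def c2_assoc)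
  also have "(g Pos a \<odot> A \<odot> g Neg b) \<odot> (e1 h' \<odot> ?j) = globe A \<odot> e1 h'"
    using s by (simp add: globe_def c2_assoc)
  finally show ?thesis by (simp add: defs)
qed


section \<open>Invertible arrows and squares\<close>

definition inv_ar :: "'b \<Rightarrow> bool"
  where "inv_ar f \<longleftrightarrow> (\<exists>h \<in> Ar. d Pos f = d Neg h \<and> f \<cdot> h = u (d Neg f) \<and>
    d Pos h = d Neg f \<and> h \<cdot> f = u (d Pos f))"

definition inv1 :: "'a \<Rightarrow> bool"
  where "inv1 A \<longleftrightarrow> (\<exists>B \<in> Sq. d1 Pos A = d1 Neg B \<and> A \<ominus> B = e1 (d1 Neg A) \<and>
    d1 Pos B = d1 Neg A \<and> B \<ominus> A = e1 (d1 Pos A))"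

definition inv2 :: "'a \<Rightarrow> bool"
  where "inv2 A \<longleftrightarrow> (\<exists>B \<in> Sq. d2 Pos A = d2 Neg B \<and> A \<odot> B = e2 (d2 Neg A) \<and>
    d2 Pos B = d2 Neg A \<and> B \<odot> A = e2 (d2 Pos A))"

text \<open>\<open>T_equation\<close> in the double category. If \<open>B\<close> has the transposed
  boundary of \<open>A\<close>, both sides are squares with top and left edge
  \<open>d1 Neg A\<close> and bottom and right edge \<open>d2 Pos A\<close>.\<close>

definition teq :: "'a \<Rightarrow> 'a \<Rightarrow> bool"
  where "teq A B \<longleftrightarrow> (g Pos (d2 Neg A) \<ominus> B) \<odot> (A \<ominus> g Neg (d1 Pos A))
    = g Neg (d1 Neg A) \<ominus> g Pos (d2 Pos A)"

lemma corners:
  assumes "A \<in> Sq"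
  shows "d Neg (d1 Neg A) = d Neg (d2 Neg A)" "d Pos (d1 Neg A) = d Neg (d2 Pos A)"
    "d Neg (d1 Pos A) = d Pos (d2 Neg A)" "d Pos (d1 Pos A) = d Pos (d2 Pos A)"
  using assms by (simp_all add: d_d1)

text \<open>Folding \<open>A \<odot> B\<close> and \<open>B \<odot> A\<close> gives two whiskered
  equations between \<open>globe A\<close> and \<open>globe B\<close>. Whiskering
  \<open>globe B\<close> by the top and bottom edges of \<open>A\<close> gives it the boundary
  opposite to that of \<open>globe A\<close> and makes it the inverse.\<close>

lemma inv1_globe_if_inv2:
  assumes A: "A \<in> Sq" and "inv2 A"
  shows "inv1 (globe A)"
proof -
  from assms(2) obtain B where B: "B \<in> Sq" and AB: "d2 Pos A = d2 Neg B" "A \<odot> B = e2 (d2 Neg A)"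
    and BA: "d2 Pos B = d2 Neg A" "B \<odot> A = e2 (d2 Pos A)" by (auto simp: inv2_def)
  define f h f' h' a b where "f = d1 Neg A" and "h = d1 Pos A" and "f' = d1 Neg B" and "h' = d1 Pos B" and "a = d2 Neg A" and "b = d2 Pos A"
  note n = this[symmetric]
  have nB: "d2 Neg B = b" "d2 Pos B = a" using AB BA by (simp_all add: n)
  have ar: "f \<in> Ar" "h \<in> Ar" "f' \<in> Ar" "h' \<in> Ar" "a \<in> Ar" "b \<in> Ar"
    using A B by (simp_all flip: n)
  have c: "d Neg f = d Neg a" "d Pos f = d Neg b" "d Neg h = d Pos a" "d Pos h = d Pos b"
    "d Neg f' = d Neg b" "d Pos f' = d Neg a" "d Neg h' = d Pos b" "d Pos h' = d Pos a"
    using corners[OF A] corners[OF B] by (simp_all add: n nB)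
  note s = A B ar c n nB
  \<comment> \<open>The top and bottom edges of the two inverse laws say that \<open>f'\<close> and
    \<open>h'\<close> are inverse to \<open>f\<close> and \<open>h\<close>.\<close>
  have "d1 \<alpha> (A \<odot> B) = u (d \<alpha> a)" "d1 \<alpha> (B \<odot> A) = u (d \<alpha> b)" for \<alpha>
    using s unfolding AB(2) BA(2) by simp_all
  from this(1)[of Neg] this(1)[of Pos] this(2)[of Neg] this(2)[of Pos]
  have inv: "f \<cdot> f' = u (d Neg a)" "h \<cdot> h' = u (d Pos a)" "f' \<cdot> f = u (d Neg b)" "h' \<cdot> h = u (d Pos b)"
    using s by simp_all
  have pAB: "(e1 f \<odot> globe B) \<ominus> (globe A \<odot> e1 h') = e1 a"
    using globe_c2[OF A B AB(1)] AB(2) s by simp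
  have pBA: "(e1 f' \<odot> globe A) \<ominus> (globe B \<odot> e1 h) = e1 b"
    using globe_c2[OF B A BA(1)] BA(2) s by simp
  \<comment> \<open>\<open>globe B\<close> goes from \<open>f' \<cdot> a\<close> to
    \<open>b \<cdot> h'\<close>, so \<open>V\<close> goes from \<open>a \<cdot> h\<close> to
    \<open>f \<cdot> b\<close>.\<close>
  define V where "V = e1 f \<odot> (globe B \<odot> e1 h)"
  have V': "V = (e1 f \<odot> globe B) \<odot> e1 h" unfolding V_def using s by (simp add: c2_assoc)
  have x: "f \<cdot> (f' \<cdot> (a \<cdot> h)) = a \<cdot> h" "b \<cdot> (h' \<cdot> h) = b"
    using s inv by (simp_all flip: m_assoc)
  have Vf: "V \<in> Sq" "d1 Neg V = a \<cdot> h" "d1 Pos V = f \<cdot> b"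
    unfolding V_def using s inv x by (simp_all add: m_assoc)
  \<comment> \<open>\<open>globe A\<close> is written as
    \<open>e1 f \<odot> (e1 f' \<odot> globe A)\<close>, so that interchange separates the whisker
    \<open>e1 f\<close> from the equation \<open>pBA\<close>.\<close>
  have "globe A \<ominus> V = (e1 f \<odot> (e1 f' \<odot> globe A)) \<ominus> (e1 f \<odot> (globe B \<odot> e1 h))"
    unfolding V_def using s inv by (simp add: c2_assoc[symmetric] e1_m[symmetric])
  also have "\<dots> = (e1 f \<ominus> e1 f) \<odot> ((e1 f' \<odot> globe A) \<ominus> (globe B \<odot> e1 h))"
    using s by (intro interchange[symmetric]) (auto simp: m_assoc)
  finally have 1: "globe A \<ominus> V = e1 (f \<cdot> b)" using s pBA by (simp add: e1_m)
  have "V \<ominus> globe A = ((e1 f \<odot> globe B) \<odot> e1 h) \<ominus> ((globe A \<odot> e1 h') \<odot> e1 h)"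
    unfolding V' using s inv by (simp add: c2_assoc e1_m[symmetric])
  also have "\<dots> = ((e1 f \<odot> globe B) \<ominus> (globe A \<odot> e1 h')) \<odot> (e1 h \<ominus> e1 h)"
    using s by (intro interchange[symmetric]) (auto simp: m_assoc)
  finally have 2: "V \<ominus> globe A = e1 (a \<cdot> h)" using s pAB by (simp add: e1_m)
  show ?thesis unfolding inv1_def using s Vf 1 2 by (intro bexI[of _ V]) auto
qed

text \<open>Same pattern as for \<open>inv2\<close> with the other pair of edges: folding uses
  \<open>globe_c1\<close>, and \<open>globe B\<close> is whiskered by the left and right edges of
  \<open>A\<close>.\<close>

lemma inv1_globe_if_inv1:
  assumes A: "A \<in> Sq" and "inv1 A"
  shows "inv1 (globe A)"
proof -
  from assms(2) obtain B where B: "B \<in> Sq" and AB: "d1 Pos A = d1 Neg B" "A \<ominus> B = e1 (d1 Neg A)"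
    and BA: "d1 Pos B = d1 Neg A" "B \<ominus> A = e1 (d1 Pos A)" by (auto simp: inv1_def)
  define f h a b a' b' where "f = d1 Neg A" and "h = d1 Pos A" and "a = d2 Neg A" and "b = d2 Pos A" and "a' = d2 Neg B" and "b' = d2 Pos B"
  note n = this[symmetric]
  have nB: "d1 Neg B = h" "d1 Pos B = f" using AB BA by (simp_all add: n)
  have ar: "f \<in> Ar" "h \<in> Ar" "a' \<in> Ar" "b' \<in> Ar" "a \<in> Ar" "b \<in> Ar"
    using A B by (simp_all flip: n)
  have c: "d Neg f = d Neg a" "d Pos f = d Neg b" "d Neg h = d Pos a" "d Pos h = d Pos b"
    "d Neg a' = d Pos a" "d Pos a' = d Neg a" "d Neg b' = d Pos b" "d Pos b' = d Neg b"
    using corners[OF A] corners[OF B] by (simp_all add: n nB)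
  note s = A B ar c n nB
  have "d2 \<alpha> (A \<ominus> B) = u (d \<alpha> f)" "d2 \<alpha> (B \<ominus> A) = u (d \<alpha> h)" for \<alpha>
    using s unfolding AB(2) BA(2) by simp_all
  from this(1)[of Neg] this(1)[of Pos] this(2)[of Neg] this(2)[of Pos]
  have inv: "a \<cdot> a' = u (d Neg a)" "b \<cdot> b' = u (d Neg b)" "a' \<cdot> a = u (d Pos a)" "b' \<cdot> b = u (d Pos b)"
    using s by simp_all
  have pAB: "(globe A \<odot> e1 b') \<ominus> (e1 a \<odot> globe B) = e1 f"
    using globe_c1[OF A B AB(1)] AB(2) s by simp
  have pBA: "(globe B \<odot> e1 b) \<ominus> (e1 a' \<odot> globe A) = e1 h"
    using globe_c1[OF B A BA(1)] BA(2) s by simp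
  define V where "V = e1 a \<odot> (globe B \<odot> e1 b)"
  have V': "V = (e1 a \<odot> globe B) \<odot> e1 b" unfolding V_def using s by (simp add: c2_assoc)
  have x: "a \<cdot> (a' \<cdot> (f \<cdot> b)) = f \<cdot> b" "h \<cdot> (b' \<cdot> b) = h"
    using s inv by (simp_all flip: m_assoc)
  have Vf: "V \<in> Sq" "d1 Neg V = a \<cdot> h" "d1 Pos V = f \<cdot> b"
    unfolding V_def using s inv x by (simp_all add: m_assoc)
  have "globe A \<ominus> V = ((globe A \<odot> e1 b') \<odot> e1 b) \<ominus> ((e1 a \<odot> globe B) \<odot> e1 b)"
    unfolding V' using s inv by (simp add: c2_assoc e1_m[symmetric])
  also have "\<dots> = ((globe A \<odot> e1 b') \<ominus> (e1 a \<odot> globe B)) \<odot> (e1 b \<ominus> e1 b)"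
    using s by (intro interchange[symmetric]) (auto simp: m_assoc)
  finally have 1: "globe A \<ominus> V = e1 (f \<cdot> b)" using s pAB by (simp add: e1_m)
  have "V \<ominus> globe A = (e1 a \<odot> (globe B \<odot> e1 b)) \<ominus> (e1 a \<odot> (e1 a' \<odot> globe A))"
    unfolding V_def using s inv by (simp add: c2_assoc[symmetric] e1_m[symmetric])
  also have "\<dots> = (e1 a \<ominus> e1 a) \<odot> ((globe B \<odot> e1 b) \<ominus> (e1 a' \<odot> globe A))"
    using s by (intro interchange[symmetric]) (auto simp: m_assoc)
  finally have 2: "V \<ominus> globe A = e1 (a \<cdot> h)" using s pBA by (simp add: e1_m)
  show ?thesis unfolding inv1_def using s Vf 1 2 by (intro bexI[of _ V]) auto
qed

text \<open>The inverse of \<open>globe A\<close> is whiskered by inverses of the top and bottom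
  edges, which gives it the boundary of the globe of a \<open>\<odot>\<close>-inverse;
  \<open>unglobe\<close> then produces that inverse.\<close>

lemma inv2_if_inv1_globe:
  assumes A: "A \<in> Sq" and "inv1 (globe A)" and "inv_ar (d1 Neg A)" "inv_ar (d1 Pos A)"
  shows "inv2 A"
proof -
  define f h a b where "f = d1 Neg A" and "h = d1 Pos A" and "a = d2 Neg A" and "b = d2 Pos A"
  note n = this[symmetric]
  have ar: "f \<in> Ar" "h \<in> Ar" "a \<in> Ar" "b \<in> Ar"
    using A by (simp_all flip: n)
  have c: "d Neg f = d Neg a" "d Pos f = d Neg b" "d Neg h = d Pos a" "d Pos h = d Pos b"
    using corners[OF A] by (simp_all add: n)
  note s0 = A ar c n
  from assms(2) obtain V where V: "V \<in> Sq" "d1 Neg V = a \<cdot> h" "d1 Pos V = f \<cdot> b"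
    and AV: "globe A \<ominus> V = e1 (f \<cdot> b)" "V \<ominus> globe A = e1 (a \<cdot> h)" using s0 by (auto simp: inv1_def)
  \<comment> \<open>\<open>inv1\<close> does not prescribe the left and right edges of
    \<open>V\<close>; they are identities because those of \<open>globe A\<close> and of the product
    are.\<close>
  have "d2 \<alpha> (globe A \<ominus> V) = u (d \<alpha> (f \<cdot> b))" for \<alpha>
    using s0 unfolding AV by simp
  from this[of Neg] this[of Pos] have V2: "d2 Neg V = u (d Neg a)" "d2 Pos V = u (d Pos b)"
    using corners[OF V(1)] s0 V by simp_all
  from assms(3) obtain f' where f': "f' \<in> Ar" "d Neg f' = d Neg b" "d Pos f' = d Neg a"
    "f \<cdot> f' = u (d Neg a)" "f' \<cdot> f = u (d Neg b)" by (auto simp: inv_ar_def s0)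
  from assms(4) obtain h' where h': "h' \<in> Ar" "d Neg h' = d Pos b" "d Pos h' = d Pos a"
    "h \<cdot> h' = u (d Pos a)" "h' \<cdot> h = u (d Pos b)" by (auto simp: inv_ar_def s0)
  note s = s0 V V2 f' h'
  have x: "f' \<cdot> (f \<cdot> k) = k" "f \<cdot> (f' \<cdot> k') = k'" if "k \<in> Ar" "d Neg k = d Neg b" "k' \<in> Ar" "d Neg k' = d Neg a" for k k'
    using s that by (simp_all flip: m_assoc)
  \<comment> \<open>\<open>V\<close> goes from \<open>a \<cdot> h\<close> to
    \<open>f \<cdot> b\<close>, so \<open>W\<close> goes from \<open>f' \<cdot> a\<close> to
    \<open>b \<cdot> h'\<close>, the globe boundary of a square with edges \<open>f'\<close>,
    \<open>h'\<close>, \<open>b\<close>, \<open>a\<close>.\<close>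
  define W where "W = e1 f' \<odot> V \<odot> e1 h'"
  have W: "W \<in> Sq" "d1 Neg W = f' \<cdot> a" "d1 Pos W = b \<cdot> h'" "d2 Neg W = u (d Neg b)" "d2 Pos W = u (d Pos a)"
    unfolding W_def using s by (simp_all add: m_assoc x)
  define B where "B = unglobe f' h' b a W"
  have psB: "globe B = W" unfolding B_def using s W by (intro globe_un) simp_all
  have B: "B \<in> Sq" "d1 Neg B = f'" "d1 Pos B = h'" "d2 Neg B = b" "d2 Pos B = a"
    unfolding B_def using s W by (simp_all add: unglobe_faces)
  note s = s W psB B
  \<comment> \<open>Both inverse laws are checked after folding: the boundaries match, so
    \<open>globe_inj\<close> reduces them to the laws for \<open>V\<close>.\<close>
  have "globe (A \<odot> B) = (e1 f \<odot> W) \<ominus> (globe A \<odot> e1 h')"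
    using s by (simp add: globe_c2)
  also have "e1 f \<odot> W = (e1 f \<odot> e1 f') \<odot> V \<odot> e1 h'"
    unfolding W_def using s by (simp add: c2_assoc)
  also have "\<dots> = V \<odot> e1 h'" using s by (simp flip: e1_m)
  also have "(V \<odot> e1 h') \<ominus> (globe A \<odot> e1 h') = (V \<ominus> globe A) \<odot> (e1 h' \<ominus> e1 h')"
    using s by (intro interchange[symmetric]) auto
  also have "\<dots> = e1 (a \<cdot> h \<cdot> h')" using s AV by (simp add: e1_m)
  also have "\<dots> = globe (e2 a)" using s by (simp add: m_assoc)
  finally have psAB: "globe (A \<odot> B) = globe (e2 a)" .
  have AB: "A \<odot> B = e2 a"
  proof (rule globe_inj)
    show "d1 \<alpha> (A \<odot> B) = d1 \<alpha> (e2 a)" for \<alpha> using s by (cases \<alpha>) simp_all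
    show "d2 \<alpha> (A \<odot> B) = d2 \<alpha> (e2 a)" for \<alpha> using s by (cases \<alpha>) simp_all
  qed (use s psAB in auto)
  have "globe (B \<odot> A) = (e1 f' \<odot> globe A) \<ominus> (W \<odot> e1 h)"
    using s by (simp add: globe_c2)
  also have "W \<odot> e1 h = e1 f' \<odot> V \<odot> (e1 h' \<odot> e1 h)"
    unfolding W_def using s by (simp add: c2_assoc)
  also have "\<dots> = e1 f' \<odot> V" using s by (simp flip: e1_m)
  also have "(e1 f' \<odot> globe A) \<ominus> (e1 f' \<odot> V) = (e1 f' \<ominus> e1 f') \<odot> (globe A \<ominus> V)"
    using s by (intro interchange[symmetric]) auto
  also have "\<dots> = e1 (f' \<cdot> (f \<cdot> b))" using s AV by (simp add: e1_m)
  also have "\<dots> = globe (e2 b)" using s by (simp add: x)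
  finally have psBA: "globe (B \<odot> A) = globe (e2 b)" .
  have BA: "B \<odot> A = e2 b"
  proof (rule globe_inj)
    show "d1 \<alpha> (B \<odot> A) = d1 \<alpha> (e2 b)" for \<alpha> using s by (cases \<alpha>) simp_all
    show "d2 \<alpha> (B \<odot> A) = d2 \<alpha> (e2 b)" for \<alpha> using s by (cases \<alpha>) simp_all
  qed (use s psBA in auto)
  show ?thesis unfolding inv2_def using s AB BA by (intro bexI[of _ B]) auto
qed

text \<open>The construction of \<open>inv2_if_inv1_globe\<close> with the left and right edges
  inverted instead; the unfolded square has edges \<open>h\<close>, \<open>f\<close>,
  \<open>a'\<close>, \<open>b'\<close> and is composed vertically with \<open>A\<close>.\<close>

lemma inv1_if_inv1_globe:
  assumes A: "A \<in> Sq" and "inv1 (globe A)" and "inv_ar (d2 Neg A)" "inv_ar (d2 Pos A)"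
  shows "inv1 A"
proof -
  define f h a b where "f = d1 Neg A" and "h = d1 Pos A" and "a = d2 Neg A" and "b = d2 Pos A"
  note n = this[symmetric]
  have ar: "f \<in> Ar" "h \<in> Ar" "a \<in> Ar" "b \<in> Ar"
    using A by (simp_all flip: n)
  have c: "d Neg f = d Neg a" "d Pos f = d Neg b" "d Neg h = d Pos a" "d Pos h = d Pos b"
    using corners[OF A] by (simp_all add: n)
  note s0 = A ar c n
  from assms(2) obtain V where V: "V \<in> Sq" "d1 Neg V = a \<cdot> h" "d1 Pos V = f \<cdot> b"
    and AV: "globe A \<ominus> V = e1 (f \<cdot> b)" "V \<ominus> globe A = e1 (a \<cdot> h)" using s0 by (auto simp: inv1_def)
  have "d2 \<alpha> (globe A \<ominus> V) = u (d \<alpha> (f \<cdot> b))" for \<alpha>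
    using s0 unfolding AV by simp
  from this[of Neg] this[of Pos] have V2: "d2 Neg V = u (d Neg a)" "d2 Pos V = u (d Pos b)"
    using corners[OF V(1)] s0 V by simp_all
  from assms(3) obtain a' where a': "a' \<in> Ar" "d Neg a' = d Pos a" "d Pos a' = d Neg a"
    "a \<cdot> a' = u (d Neg a)" "a' \<cdot> a = u (d Pos a)" by (auto simp: inv_ar_def s0)
  from assms(4) obtain b' where b': "b' \<in> Ar" "d Neg b' = d Pos b" "d Pos b' = d Neg b"
    "b \<cdot> b' = u (d Neg b)" "b' \<cdot> b = u (d Pos b)" by (auto simp: inv_ar_def s0)
  note s = s0 V V2 a' b'
  have x: "a' \<cdot> (a \<cdot> k) = k" "a \<cdot> (a' \<cdot> k') = k'" if "k \<in> Ar" "d Neg k = d Pos a" "k' \<in> Ar" "d Neg k' = d Neg a" for k k'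
    using s that by (simp_all flip: m_assoc)
  define W where "W = e1 a' \<odot> V \<odot> e1 b'"
  have W: "W \<in> Sq" "d1 Neg W = h \<cdot> b'" "d1 Pos W = a' \<cdot> f" "d2 Neg W = u (d Pos a)" "d2 Pos W = u (d Neg b)"
    unfolding W_def using s by (simp_all add: m_assoc x)
  define B where "B = unglobe h f a' b' W"
  have psB: "globe B = W" unfolding B_def using s W by (intro globe_un) simp_all
  have B: "B \<in> Sq" "d1 Neg B = h" "d1 Pos B = f" "d2 Neg B = a'" "d2 Pos B = b'"
    unfolding B_def using s W by (simp_all add: unglobe_faces)
  note s = s W psB B
  have "globe (A \<ominus> B) = (globe A \<odot> e1 b') \<ominus> (e1 a \<odot> W)"
    using s by (simp add: globe_c1)
  also have "e1 a \<odot> W = (e1 a \<odot> e1 a') \<odot> V \<odot> e1 b'"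
    unfolding W_def using s by (simp add: c2_assoc)
  also have "\<dots> = V \<odot> e1 b'" using s by (simp flip: e1_m)
  also have "(globe A \<odot> e1 b') \<ominus> (V \<odot> e1 b') = (globe A \<ominus> V) \<odot> (e1 b' \<ominus> e1 b')"
    using s by (intro interchange[symmetric]) auto
  also have "\<dots> = e1 (f \<cdot> b \<cdot> b')" using s AV by (simp add: e1_m)
  also have "\<dots> = globe (e1 f)" using s by (simp add: m_assoc)
  finally have psAB: "globe (A \<ominus> B) = globe (e1 f)" .
  have AB: "A \<ominus> B = e1 f"
  proof (rule globe_inj)
    show "d1 \<alpha> (A \<ominus> B) = d1 \<alpha> (e1 f)" for \<alpha> using s by (cases \<alpha>) simp_all
    show "d2 \<alpha> (A \<ominus> B) = d2 \<alpha> (e1 f)" for \<alpha> using s by (cases \<alpha>) simp_all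
  qed (use s psAB in auto)
  have "globe (B \<ominus> A) = (W \<odot> e1 b) \<ominus> (e1 a' \<odot> globe A)"
    using s by (simp add: globe_c1)
  also have "W \<odot> e1 b = e1 a' \<odot> V \<odot> (e1 b' \<odot> e1 b)"
    unfolding W_def using s by (simp add: c2_assoc)
  also have "\<dots> = e1 a' \<odot> V" using s by (simp flip: e1_m)
  also have "(e1 a' \<odot> V) \<ominus> (e1 a' \<odot> globe A) = (e1 a' \<ominus> e1 a') \<odot> (V \<ominus> globe A)"
    using s by (intro interchange[symmetric]) auto
  also have "\<dots> = e1 (a' \<cdot> (a \<cdot> h))" using s AV by (simp add: e1_m)
  also have "\<dots> = globe (e1 h)" using s by (simp add: x)
  finally have psBA: "globe (B \<ominus> A) = globe (e1 h)" .
  have BA: "B \<ominus> A = e1 h"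
  proof (rule globe_inj)
    show "d1 \<alpha> (B \<ominus> A) = d1 \<alpha> (e1 h)" for \<alpha> using s by (cases \<alpha>) simp_all
    show "d2 \<alpha> (B \<ominus> A) = d2 \<alpha> (e1 h)" for \<alpha> using s by (cases \<alpha>) simp_all
  qed (use s psBA in auto)
  show ?thesis unfolding inv1_def using s AB BA by (intro bexI[of _ B]) auto
qed

text \<open>Both sides of the equation have the same boundary, so they may be compared after
  folding. As connections fold to identities, the left side becomes
  \<open>globe A \<ominus> globe B\<close> and the right side an identity.\<close>

lemma teq_iff_globe:
  assumes A: "A \<in> Sq" and B: "B \<in> Sq"
    and AB: "\<And>\<alpha>. d1 \<alpha> B = d2 \<alpha> A" "\<And>\<alpha>. d2 \<alpha> B = d1 \<alpha> A"
  shows "teq A B \<longleftrightarrow> globe A \<ominus> globe B = e1 (d1 Neg (globe A))"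
proof -
  define f h a b where "f = d1 Neg A" and "h = d1 Pos A" and "a = d2 Neg A" and "b = d2 Pos A"
  note n = this[symmetric]
  have ar: "f \<in> Ar" "h \<in> Ar" "a \<in> Ar" "b \<in> Ar"
    using A by (simp_all flip: n)
  have c: "d Neg f = d Neg a" "d Pos f = d Neg b" "d Neg h = d Pos a" "d Pos h = d Pos b"
    using corners[OF A] by (simp_all add: n)
  note s = A B ar c n AB
  let ?X = "g Pos a \<ominus> B" and ?Y = "A \<ominus> g Neg h" and ?Z = "g Neg f \<ominus> g Pos b"
  have X: "?X \<in> Sq" "d1 Neg ?X = u (d Neg a)" "d1 Pos ?X = b" "d2 Neg ?X = f" "d2 Pos ?X = a \<cdot> h" "globe ?X = globe B"
    using s by (simp_all add: globe_c1 flip: e1_m)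
  have Y: "?Y \<in> Sq" "d1 Neg ?Y = f" "d1 Pos ?Y = u (d Pos b)" "d2 Neg ?Y = a \<cdot> h" "d2 Pos ?Y = b" "globe ?Y = globe A"
    using s by (simp_all add: globe_c1 flip: e1_m)
  have Z: "?Z \<in> Sq" "d1 Neg ?Z = f" "d1 Pos ?Z = b" "d2 Neg ?Z = f" "d2 Pos ?Z = b" "globe ?Z = e1 (f \<cdot> b)"
    using s by (simp_all add: globe_c1 flip: e1_m)
  have XY: "?X \<odot> ?Y \<in> Sq" "d1 Neg (?X \<odot> ?Y) = f" "d1 Pos (?X \<odot> ?Y) = b"
    "d2 Neg (?X \<odot> ?Y) = f" "d2 Pos (?X \<odot> ?Y) = b" "globe (?X \<odot> ?Y) = globe A \<ominus> globe B"
    using X Y s by (simp_all add: globe_c2 del: d_c1 c1_in)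
  have bd: "d1 \<alpha> (?X \<odot> ?Y) = d1 \<alpha> ?Z" "d2 \<alpha> (?X \<odot> ?Y) = d2 \<alpha> ?Z" for \<alpha>
    using XY Z by (cases \<alpha>; simp)+
  have "?X \<odot> ?Y = ?Z \<longleftrightarrow> globe (?X \<odot> ?Y) = globe ?Z"
    by (rule iffI, erule arg_cong, rule globe_inj[OF XY(1) Z(1) _ bd])
  then show ?thesis using XY Z s by (simp add: teq_def)
qed

lemma inv1_globe_if_teq:
  assumes A: "A \<in> Sq" and B: "B \<in> Sq"
    and AB: "\<And>\<alpha>. d1 \<alpha> B = d2 \<alpha> A" "\<And>\<alpha>. d2 \<alpha> B = d1 \<alpha> A"
    and "teq A B" "teq B A"
  shows "inv1 (globe A)"
proof -
  have "globe A \<ominus> globe B = e1 (d1 Neg (globe A))" "globe B \<ominus> globe A = e1 (d1 Neg (globe B))"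
    using teq_iff_globe[of A B] teq_iff_globe[of B A] assms by auto
  then show ?thesis unfolding inv1_def using A B AB by (intro bexI[of _ "globe B"]) auto
qed

text \<open>An inverse of \<open>globe A\<close> goes from \<open>a \<cdot> h\<close> to
  \<open>f \<cdot> b\<close>. This is already the boundary of a globe over the transposed square
  with top \<open>a\<close> and left edge \<open>f\<close>, so it unfolds directly to the second
  square.\<close>

lemma teq_if_inv1_globe:
  assumes A: "A \<in> Sq" and "inv1 (globe A)"
  shows "\<exists>B \<in> Sq. (\<forall>\<alpha>. d1 \<alpha> A = d2 \<alpha> B \<and> d2 \<alpha> A = d1 \<alpha> B) \<and> teq A B \<and> teq B A"
proof -
  define f h a b where "f = d1 Neg A" and "h = d1 Pos A" and "a = d2 Neg A" and "b = d2 Pos A"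
  note n = this[symmetric]
  have ar: "f \<in> Ar" "h \<in> Ar" "a \<in> Ar" "b \<in> Ar"
    using A by (simp_all flip: n)
  have c: "d Neg f = d Neg a" "d Pos f = d Neg b" "d Neg h = d Pos a" "d Pos h = d Pos b"
    using corners[OF A] by (simp_all add: n)
  note s0 = A ar c n
  from assms(2) obtain V where V: "V \<in> Sq" "d1 Neg V = a \<cdot> h" "d1 Pos V = f \<cdot> b"
    and AV: "globe A \<ominus> V = e1 (f \<cdot> b)" "V \<ominus> globe A = e1 (a \<cdot> h)" using s0 by (auto simp: inv1_def)
  have "d2 \<alpha> (globe A \<ominus> V) = u (d \<alpha> (f \<cdot> b))" for \<alpha>
    using s0 unfolding AV by simp
  from this[of Neg] this[of Pos] have V2: "d2 Neg V = u (d Neg a)" "d2 Pos V = u (d Pos b)"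
    using corners[OF V(1)] s0 V by simp_all
  note s = s0 V V2
  define B where "B = unglobe a b f h V"
  have psB: "globe B = V" unfolding B_def using s by (intro globe_un) simp_all
  have B: "B \<in> Sq" "d1 Neg B = a" "d1 Pos B = b" "d2 Neg B = f" "d2 Pos B = h"
    unfolding B_def using s by (simp_all add: unglobe_faces)
  have BA: "d1 \<alpha> B = d2 \<alpha> A" "d2 \<alpha> B = d1 \<alpha> A" for \<alpha>
    using s B by (cases \<alpha>; simp)+
  have "teq A B" "teq B A"
    using teq_iff_globe[OF A B(1) BA] teq_iff_globe[OF B(1) A] BA AV psB s by auto
  then show ?thesis using B(1) BA by (intro bexI[of _ B]) auto
qed

text \<open>\<open>globe A\<close> is a composite of \<open>A\<close> with connections, and by
  \<open>unglobe_globe\<close> the square \<open>A\<close> is a composite of \<open>globe A\<close>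
  with connections and degeneracies; a property closed under composition therefore passes both
  ways.\<close>

lemma globe_closed_iff:
  assumes A: "A \<in> Sq"
    and c1: "\<And>X Y. \<lbrakk>X \<in> Sq; Y \<in> Sq; d1 Pos X = d1 Neg Y; P X; P Y\<rbrakk> \<Longrightarrow> P (X \<ominus> Y)"
    and c2: "\<And>X Y. \<lbrakk>X \<in> Sq; Y \<in> Sq; d2 Pos X = d2 Neg Y; P X; P Y\<rbrakk> \<Longrightarrow> P (X \<odot> Y)"
    and e1: "\<And>\<alpha>. P (e1 (d1 \<alpha> A))" and g: "\<And>\<alpha> \<beta>. P (g \<alpha> (d2 \<beta> A))"
  shows "P (globe A) \<longleftrightarrow> P A"
proof
  assume "P A"
  then show "P (globe A)" unfolding globe_def using A g by (intro c2) (auto simp: corners)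
next
  assume "P (globe A)"
  then have "P (unglobe (d1 Neg A) (d1 Pos A) (d2 Neg A) (d2 Pos A) (globe A))"
    unfolding unglobe_def using A e1 g by (intro c1 c2) (auto simp: corners)
  then show "P A" by (simp add: unglobe_globe A)
qed

end


section \<open>Folding operations and invertibility\<close>

lemma fold_closed: "(\<And>i A. i \<in> set is \<Longrightarrow> A \<in> S \<Longrightarrow> F i A \<in> S) \<Longrightarrow> A \<in> S \<Longrightarrow> fold F is A \<in> S"
  by (induction "is" arbitrary: A) auto

lemma foldr_closed: "(\<And>i A. i \<in> set is \<Longrightarrow> A \<in> S \<Longrightarrow> F i A \<in> S) \<Longrightarrow> A \<in> S \<Longrightarrow> foldr F is A \<in> S"
  by (induction "is" arbitrary: A) auto

context cubical_omega_category
begin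

section \<open>The double category in directions \<open>i\<close> and \<open>i + 1\<close>\<close>

lemma face_face_neq:
  assumes "A \<in> cells C n" "1 \<le> i" "i \<le> n" "1 \<le> j" "j \<le> n" "i \<noteq> j"
  shows "face C (n - 1) (i \<down> j) \<alpha> (face C n j \<beta> A) = face C (n - 1) (j \<down> i) \<beta> (face C n i \<alpha> A)"
  using assms face_face[of i j n A \<beta> \<alpha>] face_face[of j i n A \<alpha> \<beta>]
  by (cases "i < j") (auto simp: idx_down_def)

text \<open>Inside a face in direction \<open>i\<close>, the remaining direction
  \<open>i + 1\<close> is renumbered to \<open>i\<close>. So the faces in both directions are arrows
  of one category, composed in direction \<open>i\<close> of dimension \<open>n - 1\<close>.\<close>

lemma double_cat:
  assumes "1 \<le> i" "i < n"
  shows "double_cat (cells C n) (cells C (n - 1)) (cells C (n - 2))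
    (face C (n - 1) i) (face C n i) (face C n (i + 1)) (degen C (n - 2) i) (star C (n - 1) i)
    (degen C (n - 1) i) (degen C (n - 1) (i + 1)) (conn C (n - 1) i) (star C n i) (star C n (i + 1))"
proof -
  \<comment> \<open>With two successors explicit, the truncated subtractions \<open>n - 1\<close>
    and \<open>n - 2\<close> compute.\<close>
  obtain k where n: "n = Suc (Suc k)" using assms by (cases n; cases "n - 1") auto
  have i: "1 \<le> i" "i \<le> Suc k" using assms n by auto
  note ax = idx_down_def idx_up_def composable_def
  show ?thesis unfolding n
  proof (unfold_locales, goal_cases)
    case (1 A) then show ?case using i face_closed[of i "Suc k" A] by simp
  next case (2 A) then show ?case using i degen_closed[of i k A] by simp
  next case 3 then show ?case using i by (simp add: star_closed ax)
  next case (4 A) then show ?case using i face_degen_eq[of i k A] by simp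
  next case 5 then show ?case using i by (simp add: face_star_Neg ax)
  next case 6 then show ?case using i by (simp add: face_star_Pos ax)
  next case 7 then show ?case using i by (simp add: star_assoc ax)
  next case (8 A) then show ?case using i star_unit_right[of i "Suc k" A] by simp
  next case (9 A) then show ?case using i star_unit_left[of i "Suc k" A] by simp
  next case (10 A) then show ?case using i face_closed[of i "Suc (Suc k)" A] by simp
  next case (11 A) then show ?case using i face_closed[of "i+1" "Suc (Suc k)" A] by simp
  next case (12 A) then show ?case using i degen_closed[of i "Suc k" A] by simp
  next case (13 A) then show ?case using i degen_closed[of "i+1" "Suc k" A] by simp
  next case (14 A) then show ?case using i conn_closed[of i "Suc k" A] by simp
  next case 15 then show ?case using i by (simp add: star_closed ax)
  next case 16 then show ?case using i by (simp add: star_closed ax)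
  next case (17 A \<alpha> \<beta>) then show ?case using i face_face[of i "i+1" "Suc (Suc k)" A] by simp
  next case (18 A) then show ?case using i face_degen_eq[of i "Suc k" A] by simp
  next case (19 f \<alpha>) then show ?case using i face_degen_neq[of "i+1" "Suc k" i f] by (simp add: ax)
  next case (20 f \<alpha>) then show ?case using i face_degen_neq[of i "Suc k" "i+1" f] by (simp add: ax)
  next case (21 A) then show ?case using i face_degen_eq[of "i+1" "Suc k" A] by simp
  next case (22 f \<alpha> \<beta>) then show ?case using i face_conn_same[of i "Suc k" i f] face_conn_opp[of i "Suc k" i f Neg]
       face_conn_opp[of i "Suc k" i f Pos] by (cases \<alpha>; cases \<beta>) auto
  next case (23 f \<alpha> \<beta>) then show ?case using i face_conn_same[of i "Suc k" "i+1" f] face_conn_opp[of i "Suc k" "i+1" f Neg]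
       face_conn_opp[of i "Suc k" "i+1" f Pos] by (cases \<alpha>; cases \<beta>) auto
  next case (24 x) then show ?case using i degen_degen[of i i k x] by simp
  next case (25 x) then show ?case using i conn_degen_eq[of i k x] by simp
  next case 26 then show ?case using i by (simp add: face_star_Neg ax)
  next case 27 then show ?case using i by (simp add: face_star_Pos ax)
  next case (28 A B \<alpha>) then show ?case using i face_star_neq[of "i+1" "Suc (Suc k)" i A B] by (simp add: ax)
  next case 29 then show ?case using i by (simp add: face_star_Neg ax)
  next case 30 then show ?case using i by (simp add: face_star_Pos ax)
  next case (31 A B \<alpha>) then show ?case using i face_star_neq[of i "Suc (Suc k)" "i+1" A B] by (simp add: ax)
  next case 32 then show ?case using i by (simp add: star_assoc ax)
  next case 33 then show ?case using i by (simp add: star_assoc ax)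
  next case (34 A) then show ?case using i star_unit_right[of i "Suc (Suc k)" A] by simp
  next case (35 A) then show ?case using i star_unit_left[of i "Suc (Suc k)" A] by simp
  next case (36 A) then show ?case using i star_unit_right[of "i+1" "Suc (Suc k)" A] by simp
  next case (37 A) then show ?case using i star_unit_left[of "i+1" "Suc (Suc k)" A] by simp
  next case (38 A B D E) then show ?case using i star_interchange[of i "Suc (Suc k)" "i+1" A B D E] by (simp add: ax)
  next case (39 f h) then show ?case using i degen_star[of i "Suc k" i f h] by (simp add: ax)
  next case (40 f h) then show ?case using i conn_Neg_star[of i "Suc k" f h] by (simp add: ax)
  next case (41 f h) then show ?case using i conn_Pos_star[of i "Suc k" f h] by (simp add: ax)
  next case (42 f) then show ?case using i conn_star_conn[of i "Suc k" f] by (simp add: ax)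
  next case (43 f) then show ?case using i conn_star_Suc_conn[of i "Suc k" f] by (simp add: ax)
  qed
qed

section \<open>Transfer of the double-categorical results to \<open>psi\<close>\<close>

context
  fixes i n :: nat
  assumes i: "1 \<le> i" "i < n"
begin

interpretation dc: double_cat "cells C n" "cells C (n - 1)" "cells C (n - 2)"
    "face C (n - 1) i" "face C n i" "face C n (i + 1)" "degen C (n - 2) i" "star C (n - 1) i"
    "degen C (n - 1) i" "degen C (n - 1) (i + 1)" "conn C (n - 1) i" "star C n i" "star C n (i + 1)"
  by (rule double_cat[OF i])

lemma globe_eq: "dc.globe A = psi C n i A"
  unfolding dc.globe_def psi_def ..

lemma inv1_eq: "dc.inv1 A \<longleftrightarrow> R_invertible C n i A"
  unfolding dc.inv1_def R_invertible_def composable_def by auto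

lemma inv2_eq: "dc.inv2 A \<longleftrightarrow> R_invertible C n (i + 1) A"
  unfolding dc.inv2_def R_invertible_def composable_def by auto

lemma inv_ar_eq: "dc.inv_ar A \<longleftrightarrow> R_invertible C (n - 1) i A"
  unfolding dc.inv_ar_def R_invertible_def composable_def by (auto simp: numeral_2_eq_2)

lemma teq_eq: "dc.teq A B \<longleftrightarrow> T_equation C n i A B"
  unfolding dc.teq_def T_equation_def ..

lemma psi_closed: "A \<in> cells C n \<Longrightarrow> psi C n i A \<in> cells C n"
  using dc.globe_faces(1) unfolding globe_eq by simp

lemma composable_psi:
  assumes "A \<in> cells C n"
  shows "composable C n (i + 1) (conn C (n - 1) i Pos (face C n (i + 1) Neg A)) A"
    "composable C n (i + 1) (star C n (i + 1) (conn C (n - 1) i Pos (face C n (i + 1) Neg A)) A)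
      (conn C (n - 1) i Neg (face C n (i + 1) Pos A))"
  using assms dc.d_c2 dc.d_g dc.g_in dc.d2_in unfolding composable_def by simp_all

lemma face_psi_Suc:
  "A \<in> cells C n \<Longrightarrow> face C n (i + 1) \<alpha> (psi C n i A) = degen C (n - 2) i (face C (n - 1) i \<alpha> (face C n i \<alpha> A))"
  using dc.globe_faces(4) unfolding globe_eq by simp

lemma psi_degen_Suc: "f \<in> cells C (n - 1) \<Longrightarrow> psi C n i (degen C (n - 1) (i + 1) f) = degen C (n - 1) i f"
  using dc.globe_e2 unfolding globe_eq by simp

lemma R_invertible_psi_if_Suc:
  "\<lbrakk>A \<in> cells C n; R_invertible C n (i + 1) A\<rbrakk> \<Longrightarrow> R_invertible C n i (psi C n i A)"
  using dc.inv1_globe_if_inv2 unfolding globe_eq inv1_eq inv2_eq by blast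

lemma R_invertible_psi:
  "\<lbrakk>A \<in> cells C n; R_invertible C n i A\<rbrakk> \<Longrightarrow> R_invertible C n i (psi C n i A)"
  using dc.inv1_globe_if_inv1 unfolding globe_eq inv1_eq inv2_eq by blast

lemma R_invertible_Suc_if_psi:
  "\<lbrakk>A \<in> cells C n; R_invertible C n i (psi C n i A); \<And>\<alpha>. R_invertible C (n - 1) i (face C n i \<alpha> A)\<rbrakk>
    \<Longrightarrow> R_invertible C n (i + 1) A"
  using dc.inv2_if_inv1_globe unfolding globe_eq inv1_eq inv2_eq inv_ar_eq by blast

lemma R_invertible_if_psi:
  "\<lbrakk>A \<in> cells C n; R_invertible C n i (psi C n i A); \<And>\<alpha>. R_invertible C (n - 1) i (face C n (i + 1) \<alpha> A)\<rbrakk>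
    \<Longrightarrow> R_invertible C n i A"
  using dc.inv1_if_inv1_globe unfolding globe_eq inv1_eq inv_ar_eq by blast

lemma T_invertible_iff_psi:
  assumes "A \<in> cells C n"
  shows "T_invertible C n i A \<longleftrightarrow> R_invertible C n i (psi C n i A)"
proof
  assume "T_invertible C n i A"
  then obtain B where B: "B \<in> cells C n" "T_inverse C n i A B" by (auto simp: T_invertible_def)
  then show "R_invertible C n i (psi C n i A)"
    using dc.inv1_globe_if_teq[OF assms B(1)] unfolding globe_eq inv1_eq teq_eq T_inverse_def by metis
next
  assume "R_invertible C n i (psi C n i A)"
  then show "T_invertible C n i A"
    using dc.teq_if_inv1_globe[OF assms] unfolding globe_eq inv1_eq teq_eq T_inverse_def T_invertible_def by blast
qed

text \<open>Both degenerate cells fold to the same identity globe, so by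
  \<open>teq_iff_globe\<close> the equation is a unit law.\<close>

lemma T_equation_degen:
  assumes "f \<in> cells C (n - 1)"
  shows "T_equation C n i (degen C (n - 1) i f) (degen C (n - 1) (i + 1) f)"
    "T_equation C n i (degen C (n - 1) (i + 1) f) (degen C (n - 1) i f)"
  using assms dc.teq_iff_globe[of "degen C (n - 1) i f" "degen C (n - 1) (i + 1) f"]
    dc.teq_iff_globe[of "degen C (n - 1) (i + 1) f" "degen C (n - 1) i f"]
  unfolding teq_eq by (simp_all del: One_nat_def add_Suc_right Suc_eq_plus1[symmetric])

text \<open>Used for properties related to \<open>R_invertible C n 1\<close> when
  \<open>2 \<le> i\<close>, in which case both compositions are transverse to direction 1.\<close>

lemma psi_closed_iff:
  assumes "A \<in> cells C n"
    and "\<And>j X Y. \<lbrakk>j \<in> {i, i + 1}; X \<in> cells C n; Y \<in> cells C n; composable C n j X Y; P X; P Y\<rbrakk> \<Longrightarrow> P (star C n j X Y)"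
    and "\<And>\<alpha>. P (degen C (n - 1) i (face C n i \<alpha> A))"
    and "\<And>\<alpha> \<beta>. P (conn C (n - 1) i \<alpha> (face C n (i + 1) \<beta> A))"
  shows "P (psi C n i A) \<longleftrightarrow> P A"
  unfolding globe_eq[symmetric] using assms
  by (intro dc.globe_closed_iff) (auto simp: composable_def)

end

section \<open>Faces and degeneracies of folded cells\<close>

lemma face_psi_neq:
  assumes i: "1 \<le> i" "i < n" and k: "1 \<le> k" "k \<le> n" "k \<noteq> i" "k \<noteq> i + 1" and A: "A \<in> cells C n"
  shows "face C n k \<alpha> (psi C n i A) = psi C (n - 1) (i \<down> k) (face C n k \<alpha> A)"
proof -
  \<comment> \<open>Directions \<open>i\<close> and \<open>i + 1\<close> stay adjacent inside the
    face: they become \<open>i \<down> k\<close> and \<open>(i \<down> k) + 1\<close>, the two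
    directions of a folding one dimension lower.\<close>
  have idx: "(i + 1) \<down> k = (i \<down> k) + 1" "k \<down> (i + 1) = k \<down> i" "n - 1 + 1 = n" "n - 1 - 1 = n - 2"
    using assms by (auto simp: idx_down_def)
  have f: "face C n (i + 1) \<beta> A \<in> cells C (n - 1)" for \<beta>
    using face_closed[of "i + 1" n A \<beta>] assms by simp
  have g: "conn C (n - 1) i \<gamma> (face C n (i + 1) \<beta> A) \<in> cells C n" for \<beta> \<gamma>
    using conn_closed[OF _ _ f[of \<beta>], of i \<gamma>] assms by simp
  have fg: "face C n k \<alpha> (conn C (n - 1) i \<gamma> (face C n (i + 1) \<beta> A))
     = conn C (n - 2) (i \<down> k) \<gamma> (face C (n - 1) ((i \<down> k) + 1) \<beta> (face C n k \<alpha> A))" for \<beta> \<gamma>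
  proof -
    have "face C n k \<alpha> (conn C (n - 1) i \<gamma> (face C n (i + 1) \<beta> A))
      = conn C (n - 1 - 1) (i \<down> k) \<gamma> (face C (n - 1) (k \<down> i) \<alpha> (face C n (i + 1) \<beta> A))"
      using face_conn_neq[of k "n - 1" i "face C n (i + 1) \<beta> A" \<alpha> \<gamma>] f[of \<beta>] assms by simp
    also have "face C (n - 1) (k \<down> i) \<alpha> (face C n (i + 1) \<beta> A)
      = face C (n - 1) ((i \<down> k) + 1) \<beta> (face C n k \<alpha> A)"
      using face_face_neq[of A n k "i + 1" \<alpha> \<beta>, unfolded idx] assms by simp
    finally show ?thesis unfolding idx .
  qed
  note c = composable_psi[OF i A]
  have s: "star C n (i + 1) (conn C (n - 1) i Pos (face C n (i + 1) Neg A)) A \<in> cells C n"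
    using star_closed[OF _ _ g A c(1)] i by simp
  show ?thesis
    unfolding psi_def
    using face_star_neq[OF k(1,2) _ _ k(4) s g c(2)] face_star_neq[OF k(1,2) _ _ k(4) g A c(1)] i
    by (simp add: fg idx flip: One_nat_def)
qed

text \<open>Lets all but the last folding operation of a \<open>Psi\<close> pass a degeneracy
  without changing its index; the last one lowers the index by \<open>psi_degen_Suc\<close>.\<close>

lemma psi_degen_less:
  assumes i: "1 \<le> i" "i + 1 < m" "m \<le> n + 1" and A: "A \<in> cells C n"
  shows "psi C (n + 1) i (degen C n m A) = degen C n m (psi C n i A)"
proof -
  have n: "i < n" using i by simp
  have idx: "(i + 1) \<up> m = i + 1" "(m - 1) \<up> i = m" "i \<down> (m - 1) = i"
    "m \<down> (i + 1) = m - 1" "(i + 1) \<down> m = i + 1" "n - 1 + 1 = n"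
    using assms by (auto simp: idx_down_def idx_up_def)
  have f: "face C n (i + 1) \<beta> A \<in> cells C (n - 1)" for \<beta>
    using face_closed[of "i + 1" n A \<beta>] assms by simp
  have g: "conn C (n - 1) i \<gamma> (face C n (i + 1) \<beta> A) \<in> cells C n" for \<beta> \<gamma>
    using conn_closed[OF _ _ f[of \<beta>], of i \<gamma>] assms by simp
  have e: "face C (n + 1) (i + 1) \<beta> (degen C n m A) = degen C (n - 1) (m - 1) (face C n (i + 1) \<beta> A)" for \<beta>
    using face_degen_neq[of "i + 1" n m A \<beta>] assms by (simp add: idx del: One_nat_def)
  have cg: "conn C n i \<gamma> (degen C (n - 1) (m - 1) (face C n (i + 1) \<beta> A))
      = degen C n m (conn C (n - 1) i \<gamma> (face C n (i + 1) \<beta> A))" for \<beta> \<gamma>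
    using conn_degen_neq[of i "n - 1" "m - 1" _ \<gamma>, OF _ _ _ _ _ f[of \<beta>]] assms by (simp add: idx del: One_nat_def)
  note c = composable_psi[OF i(1) n A]
  have s: "star C n (i + 1) (conn C (n - 1) i Pos (face C n (i + 1) Neg A)) A \<in> cells C n"
    using star_closed[OF _ _ g A c(1)] i by simp
  show ?thesis
    unfolding psi_def
    using degen_star[OF _ _ _ _ s g c(2), of m] degen_star[OF _ _ _ _ g A c(1), of m] i
    by (simp add: e cg idx del: One_nat_def)
qed

section \<open>Calculus of inverses in direction 1\<close>

definition R_inverse :: "nat \<Rightarrow> nat \<Rightarrow> 'a \<Rightarrow> 'a \<Rightarrow> bool"
  where "R_inverse n k A B \<longleftrightarrow>
      composable C n k A B \<and> star C n k A B = degen C (n - 1) k (face C n k Neg A) \<and>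
      composable C n k B A \<and> star C n k B A = degen C (n - 1) k (face C n k Pos A)"

lemma R_invertible_iff: "R_invertible C n k A \<longleftrightarrow> (\<exists>B \<in> cells C n. R_inverse n k A B)"
  by (simp add: R_invertible_def R_inverse_def)

lemma R_inverse_sym: "R_inverse n k A B \<Longrightarrow> R_inverse n k B A"
  by (simp add: R_inverse_def composable_def)

text \<open>Both laws are put in the same form, so that below one auxiliary fact
  \<open>half\<close>, applied in both orders, proves both.\<close>

lemma R_inverseI:
  assumes "composable C n k A B" "star C n k A B = degen C (n - 1) k (face C n k Neg A)"
    "composable C n k B A" "star C n k B A = degen C (n - 1) k (face C n k Neg B)"
  shows "R_inverse n k A B"
  using assms by (simp add: R_inverse_def composable_def)

text \<open>The argument for monoids. It serves to show that inverses of composable cells are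
  composable, and is the reason for making the inverse explicit in \<open>R_inverse\<close>.\<close>

lemma R_inverse_unique:
  assumes k: "1 \<le> k" "k \<le> n" and A: "A \<in> cells C n" and B: "B \<in> cells C n" "R_inverse n k A B"
    and D: "D \<in> cells C n" "R_inverse n k A D"
  shows "B = D"
proof -
  have "B = star C n k B (degen C (n - 1) k (face C n k Pos B))"
    using star_unit_right[OF k B(1)] by simp
  also have "degen C (n - 1) k (face C n k Pos B) = star C n k A D"
    using B D by (simp add: R_inverse_def composable_def)
  also have "star C n k B (star C n k A D) = star C n k (star C n k B A) D"
    using star_assoc[OF k B(1) A D(1)] B D by (simp add: R_inverse_def)
  also have "\<dots> = D" using star_unit_left[OF k D(1)] B D by (simp add: R_inverse_def composable_def)
  finally show ?thesis .
qed

text \<open>Faces, compositions, connections and degeneracies in directions \<open>j \<ge> 2\<close>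
  are functorial for composition in direction 1 and its units, so they preserve inverses. The next
  three lemmas rest on the same principle.\<close>

lemma R_inverse_face:
  assumes j: "2 \<le> j" "j \<le> n" and A: "A \<in> cells C n" and B: "B \<in> cells C n" and AB: "R_inverse n 1 A B"
  shows "R_inverse (n - 1) 1 (face C n j \<alpha> A) (face C n j \<alpha> B)"
proof -
  have half: "composable C (n - 1) 1 (face C n j \<alpha> X) (face C n j \<alpha> Y) \<and>
     star C (n - 1) 1 (face C n j \<alpha> X) (face C n j \<alpha> Y) = degen C (n - 1 - 1) 1 (face C (n - 1) 1 Neg (face C n j \<alpha> X))"
    if X: "X \<in> cells C n" and Y: "Y \<in> cells C n" and XY: "R_inverse n 1 X Y" for X Y
  proof
    have c: "composable C n 1 X Y" using XY by (simp add: R_inverse_def)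
    have ff: "face C (n - 1) 1 \<beta> (face C n j \<alpha> Z) = face C (n - 1) (j - 1) \<alpha> (face C n 1 \<beta> Z)" if "Z \<in> cells C n" for \<beta> Z
      using face_face[of 1 j n Z \<alpha> \<beta>] that j by simp
    show "composable C (n - 1) 1 (face C n j \<alpha> X) (face C n j \<alpha> Y)"
      using c X Y by (simp add: composable_def ff del: One_nat_def)
    have f: "face C n 1 Neg X \<in> cells C (n - 1)" using face_closed[of 1 n X] X j by simp
    have "star C (n - 1) 1 (face C n j \<alpha> X) (face C n j \<alpha> Y) = face C n j \<alpha> (star C n 1 X Y)"
      using face_star_neq[OF _ _ _ _ _ X Y c, of j] j by (simp add: idx_down_def)
    also have "star C n 1 X Y = degen C (n - 1) 1 (face C n 1 Neg X)" using XY by (simp add: R_inverse_def)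
    also have "face C n j \<alpha> \<dots> = degen C (n - 1 - 1) 1 (face C (n - 1) (j - 1) \<alpha> (face C n 1 Neg X))"
      using face_degen_neq[of j "n - 1" 1, OF _ _ _ _ _ f] j by (simp add: idx_down_def)
    finally show "star C (n - 1) 1 (face C n j \<alpha> X) (face C n j \<alpha> Y) = degen C (n - 1 - 1) 1 (face C (n - 1) 1 Neg (face C n j \<alpha> X))"
      using X by (simp add: ff del: One_nat_def)
  qed
  show ?thesis using half[OF A B AB] half[OF B A R_inverse_sym[OF AB]] by (intro R_inverseI) auto
qed

lemma R_inverse_star:
  assumes j: "2 \<le> j" "j \<le> n" and A: "A \<in> cells C n" "A' \<in> cells C n" "R_inverse n 1 A A'"
    and B: "B \<in> cells C n" "B' \<in> cells C n" "R_inverse n 1 B B'" and AB: "composable C n j A B"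
  shows "composable C n j A' B'" "R_inverse n 1 (star C n j A B) (star C n j A' B')"
proof -
  \<comment> \<open>The positive face of \<open>A'\<close> and the negative face of
    \<open>B'\<close> are both inverse to the common face of \<open>A\<close> and \<open>B\<close>,
    hence equal.\<close>
  have "R_inverse (n - 1) 1 (face C n j Pos A) (face C n j Pos A')"
    "R_inverse (n - 1) 1 (face C n j Pos A) (face C n j Neg B')"
    using R_inverse_face[OF j A, of Pos] R_inverse_face[OF j B, of Neg] AB by (simp_all add: composable_def)
  then show AB': "composable C n j A' B'"
    unfolding composable_def using j A B by (intro R_inverse_unique[of 1 "n - 1" "face C n j Pos A"] face_closed) auto
  have half: "composable C n 1 (star C n j X Y) (star C n j X' Y') \<and>
     star C n 1 (star C n j X Y) (star C n j X' Y') = degen C (n - 1) 1 (face C n 1 Neg (star C n j X Y))"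
    if X: "X \<in> cells C n" "X' \<in> cells C n" "R_inverse n 1 X X'"
      and Y: "Y \<in> cells C n" "Y' \<in> cells C n" "R_inverse n 1 Y Y'"
      and c: "composable C n j X Y" "composable C n j X' Y'" for X X' Y Y'
  proof
    have f: "face C n 1 \<beta> Z \<in> cells C (n - 1)" if "Z \<in> cells C n" for Z \<beta>
      using face_closed[of 1 n Z] that j by simp
    have fs: "face C n 1 \<beta> (star C n j Z W) = star C (n - 1) (j - 1) (face C n 1 \<beta> Z) (face C n 1 \<beta> W)"
      if "Z \<in> cells C n" "W \<in> cells C n" "composable C n j Z W" for \<beta> Z W
      using face_star_neq[of 1 n j Z W \<beta>] that j by (simp add: idx_down_def)
    show "composable C n 1 (star C n j X Y) (star C n j X' Y')"
      unfolding composable_def using X Y c by (simp add: fs R_inverse_def composable_def del: One_nat_def)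
    have "composable C (n - 1) (j - 1) (face C n 1 Neg X) (face C n 1 Neg Y)"
      using face_face[of 1 j n X Pos Neg] face_face[of 1 j n Y Neg Neg] X Y c j by (simp add: composable_def)
    then have "degen C (n - 1) 1 (face C n 1 Neg (star C n j X Y)) = star C n j (degen C (n - 1) 1 (face C n 1 Neg X)) (degen C (n - 1) 1 (face C n 1 Neg Y))"
      using degen_star[of 1 "n - 1" "j - 1", OF _ _ _ _ f[OF X(1)] f[OF Y(1)]] X Y c j
      by (simp add: idx_up_def fs flip: One_nat_def)
    also have "\<dots> = star C n j (star C n 1 X X') (star C n 1 Y Y')"
      using X Y by (simp add: R_inverse_def)
    also have "\<dots> = star C n 1 (star C n j X Y) (star C n j X' Y')"
      using star_interchange[of j n 1 X Y X' Y'] X Y c j by (simp add: R_inverse_def)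
    finally show "star C n 1 (star C n j X Y) (star C n j X' Y') = degen C (n - 1) 1 (face C n 1 Neg (star C n j X Y))"
      by simp
  qed
  show "R_inverse n 1 (star C n j A B) (star C n j A' B')"
    using half[OF A B AB AB'] half[OF A(2,1) R_inverse_sym[OF A(3)] B(2,1) R_inverse_sym[OF B(3)] AB' AB]
    by (intro R_inverseI) auto
qed

lemma R_inverse_conn:
  assumes j: "2 \<le> j" "j \<le> n" and A: "A \<in> cells C n" and B: "B \<in> cells C n" and AB: "R_inverse n 1 A B"
  shows "R_inverse (n + 1) 1 (conn C n j \<alpha> A) (conn C n j \<alpha> B)"
proof -
  have half: "composable C (n + 1) 1 (conn C n j \<alpha> X) (conn C n j \<alpha> Y) \<and>
     star C (n + 1) 1 (conn C n j \<alpha> X) (conn C n j \<alpha> Y) = degen C (n + 1 - 1) 1 (face C (n + 1) 1 Neg (conn C n j \<alpha> X))"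
    if X: "X \<in> cells C n" and Y: "Y \<in> cells C n" and XY: "R_inverse n 1 X Y" for X Y
  proof
    have c: "composable C n 1 X Y" using XY by (simp add: R_inverse_def)
    have fc: "face C (n + 1) 1 \<beta> (conn C n j \<alpha> Z) = conn C (n - 1) (j - 1) \<alpha> (face C n 1 \<beta> Z)" if "Z \<in> cells C n" for \<beta> Z
      using face_conn_neq[of 1 n j Z \<beta> \<alpha>] that j by (simp add: idx_down_def)
    show "composable C (n + 1) 1 (conn C n j \<alpha> X) (conn C n j \<alpha> Y)"
      using c X Y by (simp add: composable_def fc del: One_nat_def Suc_eq_plus1[symmetric] add_Suc_right)
    have f: "face C n 1 Neg X \<in> cells C (n - 1)" using face_closed[of 1 n X] X j by simp
    have "star C (n + 1) 1 (conn C n j \<alpha> X) (conn C n j \<alpha> Y) = conn C n j \<alpha> (star C n 1 X Y)"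
      using conn_star_neq[OF _ _ _ _ _ X Y c, of j \<alpha>] j by (simp add: idx_up_def)
    also have "star C n 1 X Y = degen C (n - 1) 1 (face C n 1 Neg X)" using XY by (simp add: R_inverse_def)
    also have "conn C n j \<alpha> \<dots> = degen C n 1 (conn C (n - 1) (j - 1) \<alpha> (face C n 1 Neg X))"
      using conn_degen_neq[of j "n - 1" 1, OF _ _ _ _ _ f] j by (simp add: idx_down_def idx_up_def)
    finally show "star C (n + 1) 1 (conn C n j \<alpha> X) (conn C n j \<alpha> Y) = degen C (n + 1 - 1) 1 (face C (n + 1) 1 Neg (conn C n j \<alpha> X))"
      using fc[OF X] by simp
  qed
  show ?thesis using half[OF A B AB] half[OF B A R_inverse_sym[OF AB]] by (intro R_inverseI) auto
qed

lemma R_inverse_degen: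
  assumes j: "2 \<le> j" "j \<le> n + 1" and n: "1 \<le> n"
    and A: "A \<in> cells C n" and B: "B \<in> cells C n" and AB: "R_inverse n 1 A B"
  shows "R_inverse (n + 1) 1 (degen C n j A) (degen C n j B)"
proof -
  have half: "composable C (n + 1) 1 (degen C n j X) (degen C n j Y) \<and>
     star C (n + 1) 1 (degen C n j X) (degen C n j Y) = degen C (n + 1 - 1) 1 (face C (n + 1) 1 Neg (degen C n j X))"
    if X: "X \<in> cells C n" and Y: "Y \<in> cells C n" and XY: "R_inverse n 1 X Y" for X Y
  proof
    have c: "composable C n 1 X Y" using XY by (simp add: R_inverse_def)
    have fc: "face C (n + 1) 1 \<beta> (degen C n j Z) = degen C (n - 1) (j - 1) (face C n 1 \<beta> Z)" if "Z \<in> cells C n" for \<beta> Z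
      using face_degen_neq[of 1 n j Z \<beta>] that j by (simp add: idx_down_def)
    show "composable C (n + 1) 1 (degen C n j X) (degen C n j Y)"
      using c fc[OF X] fc[OF Y] by (simp add: composable_def)
    have f: "face C n 1 Neg X \<in> cells C (n - 1)" using face_closed[of 1 n X] X n by simp
    have "star C (n + 1) 1 (degen C n j X) (degen C n j Y) = degen C n j (star C n 1 X Y)"
      using degen_star[OF _ _ _ _ X Y c, of j] j n by (simp add: idx_up_def)
    also have "star C n 1 X Y = degen C (n - 1) 1 (face C n 1 Neg X)" using XY by (simp add: R_inverse_def)
    also have "degen C n j \<dots> = degen C n 1 (degen C (n - 1) (j - 1) (face C n 1 Neg X))"
      using degen_degen[of 1 "j - 1" "n - 1", OF _ _ _ f] j n by simp
    finally show "star C (n + 1) 1 (degen C n j X) (degen C n j Y) = degen C (n + 1 - 1) 1 (face C (n + 1) 1 Neg (degen C n j X))"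
      using fc[OF X] by simp
  qed
  show ?thesis using half[OF A B AB] half[OF B A R_inverse_sym[OF AB]] by (intro R_inverseI) auto
qed

section \<open>Closure properties of R-invertible cells\<close>

lemma R_invertible_degen:
  assumes "1 \<le> k" "k \<le> n" "X \<in> cells C (n - 1)"
  shows "R_invertible C n k (degen C (n - 1) k X)"
proof -
  have "degen C (n - 1) k X \<in> cells C n" "\<And>\<alpha>. face C n k \<alpha> (degen C (n - 1) k X) = X"
    using degen_closed[of k "n - 1" X] face_degen_eq[of k "n - 1" X] assms by simp_all
  \<comment> \<open>A degenerate cell is an identity, hence its own inverse.\<close>
  then show ?thesis
    using star_unit_left[of k n "degen C (n - 1) k X"] assms unfolding R_invertible_def composable_def
    by (intro bexI[of _ "degen C (n - 1) k X"]) simp_all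
qed

text \<open>The condition that stands in for an invertible shell: it mentions only cells of
  \<open>C\<close>, and \<open>R_invertible_faces_if_shell\<close> derives it from the shell. The
  index \<open>k \<down> j\<close> is direction \<open>k\<close> as numbered inside the face in
  direction \<open>j\<close>.\<close>

definition R_invertible_faces :: "nat \<Rightarrow> nat \<Rightarrow> 'a \<Rightarrow> bool"
  where "R_invertible_faces n k A \<longleftrightarrow>
    (\<forall>j \<in> {1..n} - {k}. \<forall>\<alpha>. R_invertible C (n - 1) (k \<down> j) (face C n j \<alpha> A))"

lemma R_invertible_faces_1:
  "R_invertible_faces n 1 A \<longleftrightarrow> (\<forall>j \<in> {2..n}. \<forall>\<alpha>. R_invertible C (n - 1) 1 (face C n j \<alpha> A))"
  by (force simp: R_invertible_faces_def idx_down_def)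

lemma R_invertible_faces_if:
  assumes "A \<in> cells C n" "R_invertible C n 1 A"
  shows "R_invertible_faces n 1 A"
  using assms unfolding R_invertible_faces_1 R_invertible_iff
  by (auto simp del: One_nat_def intro!: bexI R_inverse_face face_closed)

lemma R_invertible_star:
  assumes "2 \<le> j" "j \<le> n" "A \<in> cells C n" "B \<in> cells C n" "composable C n j A B"
    "R_invertible C n 1 A" "R_invertible C n 1 B"
  shows "R_invertible C n 1 (star C n j A B)"
proof -
  obtain A' B' where "A' \<in> cells C n" "R_inverse n 1 A A'" "B' \<in> cells C n" "R_inverse n 1 B B'"
    using assms by (auto simp: R_invertible_iff)
  then show ?thesis
    using R_inverse_star[of j n A A' B B'] star_closed[of j n A' B'] assms unfolding R_invertible_iff by auto
qed

lemma R_invertible_conn: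
  assumes "2 \<le> j" "j \<le> n" "A \<in> cells C n" "R_invertible C n 1 A"
  shows "R_invertible C (n + 1) 1 (conn C n j \<alpha> A)"
  using assms R_inverse_conn[of j n A] conn_closed[of j n] unfolding R_invertible_iff
  by (meson dual_order.trans one_le_numeral)

lemma R_invertible_degen_neq:
  assumes "2 \<le> j" "j \<le> n + 1" "1 \<le> n" "A \<in> cells C n" "R_invertible C n 1 A"
  shows "R_invertible C (n + 1) 1 (degen C n j A)"
  using assms R_inverse_degen[of j n A] degen_closed[of j n] unfolding R_invertible_iff
  by (meson dual_order.trans one_le_numeral)

lemma R_invertible_faces_star:
  assumes j: "2 \<le> j" "j \<le> n" and A: "A \<in> cells C n" and B: "B \<in> cells C n" and AB: "composable C n j A B"
    and "R_invertible_faces n 1 A" "R_invertible_faces n 1 B"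
  shows "R_invertible_faces n 1 (star C n j A B)"
  unfolding R_invertible_faces_1
proof (intro ballI allI)
  fix k \<alpha> assume k: "k \<in> {2..n}"
  have AB': "R_invertible C (n - 1) 1 (face C n k \<beta> A)" "R_invertible C (n - 1) 1 (face C n k \<beta> B)" for \<beta>
    using assms k unfolding R_invertible_faces_1 by auto
  show "R_invertible C (n - 1) 1 (face C n k \<alpha> (star C n j A B))"
  proof (cases "k = j")
    case True
    then show ?thesis using face_star_Neg[OF _ _ A B AB] face_star_Pos[OF _ _ A B AB] AB' j by (cases \<alpha>) auto
  next
    case False
    have "composable C (n - 1) (j \<down> k) (face C n k \<alpha> A) (face C n k \<alpha> B)"
      using face_face_neq[of _ n j k Pos \<alpha>, OF A] face_face_neq[of _ n j k Neg \<alpha>, OF B] AB j k False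
      by (simp add: composable_def)
    moreover have "2 \<le> j \<down> k" "j \<down> k \<le> n - 1" using j k False by (auto simp: idx_down_def)
    moreover have "face C n k \<alpha> (star C n j A B) = star C (n - 1) (j \<down> k) (face C n k \<alpha> A) (face C n k \<alpha> B)"
      using face_star_neq[OF _ _ _ _ False A B AB] j k by simp
    ultimately show ?thesis
      using R_invertible_star face_closed[of k n] A B AB' k by auto
  qed
qed

text \<open>For \<open>i = 1\<close> the double category applies, and the invertible faces in
  direction 2 allow unfolding. For \<open>i \<ge> 2\<close>, \<open>psi C n i A\<close> and
  \<open>A\<close> arise from each other by transverse compositions with invertible cells, so
  closure under such compositions is enough.\<close>

lemma R_invertible_faces_psi:
  assumes i: "1 \<le> i" "i < n" and A: "A \<in> cells C n" and R: "R_invertible_faces n 1 A"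
  shows "R_invertible_faces n 1 (psi C n i A)"
    and "R_invertible C n 1 (psi C n i A) \<Longrightarrow> R_invertible C n 1 A"
proof -
  have R': "R_invertible C (n - 1) 1 (face C n k \<alpha> A)" if "2 \<le> k" "k \<le> n" for k \<alpha>
    using R that unfolding R_invertible_faces_1 by auto
  have f: "face C n k \<alpha> A \<in> cells C (n - 1)" if "1 \<le> k" "k \<le> n" for k \<alpha>
    using face_closed A that by auto
  have n: "n - 1 + 1 = n" using i by simp
  have "R_invertible_faces n 1 (psi C n i A) \<and> (R_invertible C n 1 (psi C n i A) \<longrightarrow> R_invertible C n 1 A)"
  proof (cases "i = 1")
    case True
    \<comment> \<open>The face of \<open>psi C n 1 A\<close> is degenerate in direction 2; in higher
      directions it is the folding of a face of \<open>A\<close>.\<close>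
    have "R_invertible C (n - 1) 1 (face C n k \<alpha> (psi C n 1 A))" if k: "2 \<le> k" "k \<le> n" for k \<alpha>
    proof (cases "k = 2")
      case True
      then show ?thesis
        using face_psi_Suc[of 1 n A \<alpha>] R_invertible_degen[of 1 "n - 1" "face C (n - 1) 1 \<alpha> (face C n 1 \<alpha> A)"]
          face_closed[of 1 "n - 1", OF _ _ f[of 1 \<alpha>]] A k by (simp add: numeral_2_eq_2)
    next
      case False
      then show ?thesis
        using face_psi_neq[of 1 n k A \<alpha>] R_invertible_psi[of 1 "n - 1" "face C n k \<alpha> A"] f[of k \<alpha>] R' A k
        by (simp add: idx_down_def)
    qed
    moreover have "R_invertible C n 1 A" if "R_invertible C n 1 (psi C n 1 A)"
      using R_invertible_if_psi[OF _ _ A that] R' i True by simp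
    ultimately show ?thesis unfolding R_invertible_faces_1 True by auto
  next
    case False
    then have i2: "2 \<le> i" using i by simp
    have e: "degen C (n - 1) i (face C n i \<alpha> A) \<in> cells C n"
      "R_invertible C n 1 (degen C (n - 1) i (face C n i \<alpha> A))" for \<alpha>
      using R_invertible_degen_neq[of i "n - 1" "face C n i \<alpha> A", unfolded n] f[of i \<alpha>] R'[of i \<alpha>] i i2
        degen_closed[of i "n - 1", unfolded n] by auto
    have g: "conn C (n - 1) i \<alpha> (face C n (i + 1) \<beta> A) \<in> cells C n"
      "R_invertible C n 1 (conn C (n - 1) i \<alpha> (face C n (i + 1) \<beta> A))" for \<alpha> \<beta>
      using R_invertible_conn[of i "n - 1" "face C n (i + 1) \<beta> A", unfolded n] f[of "i + 1" \<beta>] R'[of "i + 1" \<beta>] i i2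
        conn_closed[of i "n - 1", unfolded n] by auto
    have "R_invertible_faces n 1 (psi C n i A) \<longleftrightarrow> R_invertible_faces n 1 A"
      by (rule psi_closed_iff[OF i A], rule R_invertible_faces_star)
        (use i i2 e g in \<open>auto intro: R_invertible_faces_if[simplified]\<close>)
    moreover have "R_invertible C n 1 (psi C n i A) \<longleftrightarrow> R_invertible C n 1 A"
      by (rule psi_closed_iff[OF i A], rule R_invertible_star) (use i i2 e g in auto)
    ultimately show ?thesis using R by simp
  qed
  then show "R_invertible_faces n 1 (psi C n i A)"
    and "R_invertible C n 1 (psi C n i A) \<Longrightarrow> R_invertible C n 1 A" by auto
qed

text \<open>The three properties are bundled so that they survive composition of functions, which
  settles lists of folding operations by induction.\<close>

definition reflects_inv :: "nat \<Rightarrow> ('a \<Rightarrow> 'a) \<Rightarrow> bool"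
  where "reflects_inv n F \<longleftrightarrow> (\<forall>A \<in> cells C n. R_invertible_faces n 1 A \<longrightarrow>
    F A \<in> cells C n \<and> R_invertible_faces n 1 (F A) \<and> (R_invertible C n 1 (F A) \<longrightarrow> R_invertible C n 1 A))"

lemma reflects_psi: "1 \<le> i \<Longrightarrow> i < n \<Longrightarrow> reflects_inv n (psi C n i)"
  using R_invertible_faces_psi psi_closed unfolding reflects_inv_def by blast

lemma reflects_fold: "(\<And>i. i \<in> set is \<Longrightarrow> reflects_inv n (F i)) \<Longrightarrow> reflects_inv n (fold F is)"
  by (induction "is") (auto simp: reflects_inv_def)

lemma reflects_foldr: "(\<And>i. i \<in> set is \<Longrightarrow> reflects_inv n (F i)) \<Longrightarrow> reflects_inv n (foldr F is)"
  by (induction "is") (auto simp: reflects_inv_def)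

lemma reflects_Phi: "reflects_inv n (Phi C n)"
proof -
  have "reflects_inv n (Psi C n r)" if "r \<le> n" for r
    unfolding Psi_def using that by (intro reflects_fold reflects_psi) auto
  then show ?thesis unfolding Phi_def by (intro reflects_foldr) auto
qed

section \<open>Transverse faces of fully folded cells\<close>

lemma fold_psi_closed: "r \<le> n \<Longrightarrow> A \<in> cells C n \<Longrightarrow> fold (psi C n) [1..<r] A \<in> cells C n"
  by (rule fold_closed) (auto intro: psi_closed)

lemma Psi_closed: "r \<le> n \<Longrightarrow> A \<in> cells C n \<Longrightarrow> Psi C n r A \<in> cells C n"
  by (simp add: Psi_def fold_psi_closed del: One_nat_def)

lemma foldr_psi_closed: "\<lbrakk>1 \<le> l; r \<le> n; A \<in> cells C n\<rbrakk> \<Longrightarrow> foldr (psi C n) [l..<r] A \<in> cells C n"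
  by (rule foldr_closed) (auto intro: psi_closed)

lemma foldr_Psi_closed: "\<lbrakk>r \<le> n + 1; A \<in> cells C n\<rbrakk> \<Longrightarrow> foldr (Psi C n) [l..<r] A \<in> cells C n"
  by (rule foldr_closed) (auto intro: Psi_closed)

text \<open>These folding operations involve directions up to \<open>r\<close> only, so a face in
  direction \<open>k > r\<close> passes through them without renumbering. The next two lemmas rest
  on the same observation.\<close>

lemma face_foldr_psi:
  assumes "r < k" "k \<le> n" "A \<in> cells C n"
  shows "face C n k \<alpha> (foldr (psi C n) [1..<r] A) = foldr (psi C (n - 1)) [1..<r] (face C n k \<alpha> A)"
  using assms
proof (induction r arbitrary: A)
  case (Suc r)
  show ?case
  proof (cases "1 \<le> r")
    case True
    then show ?thesis
      using Suc face_psi_neq[of r n k A \<alpha>] psi_closed[of r n A] by (simp add: idx_down_def)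
  qed simp
qed simp

lemma face_fold_psi:
  assumes "r < k" "k \<le> n" "A \<in> cells C n"
  shows "face C n k \<alpha> (fold (psi C n) [1..<r] A) = fold (psi C (n - 1)) [1..<r] (face C n k \<alpha> A)"
  using assms
proof (induction r)
  case (Suc r)
  show ?case
  proof (cases "1 \<le> r")
    case True
    then show ?thesis
      using Suc face_psi_neq[of r n k "fold (psi C n) [1..<r] A" \<alpha>] fold_psi_closed[of r n A]
      by (simp add: idx_down_def)
  qed simp
qed simp

lemma face_foldr_Psi:
  assumes "r \<le> k" "k \<le> n" "A \<in> cells C n"
  shows "face C n k \<alpha> (foldr (Psi C n) [1..<r] A) = foldr (Psi C (n - 1)) [1..<r] (face C n k \<alpha> A)"
  using assms
proof (induction r arbitrary: A)
  case (Suc r)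
  show ?case
  proof (cases "1 \<le> r")
    case True
    then show ?thesis
      using Suc.IH[of "Psi C n r A"] Suc.prems face_fold_psi[of r k n A \<alpha>] Psi_closed[of r n A]
      by (simp add: Psi_def)
  qed simp
qed simp

text \<open>\<open>foldr\<close> starts with the last entry \<open>i - 1\<close>, and each
  \<open>\<psi>\<^sub>j\<close> turns \<open>\<epsilon>\<^sub>j\<^sub>+\<^sub>1\<close> into
  \<open>\<epsilon>\<^sub>j\<close>, so the degeneracy moves down to direction 1.\<close>

lemma foldr_psi_degen:
  assumes "1 \<le> i" "i \<le> m + 1" "X \<in> cells C m"
  shows "foldr (psi C (m + 1)) [1..<i] (degen C m i X) = degen C m 1 X"
  using assms
proof (induction i rule: nat_induct_at_least)
  case (Suc i)
  then show ?case using psi_degen_Suc[of i "m + 1" X] by simp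
qed simp

lemma fold_psi_degen:
  assumes "r < i" "i \<le> m + 1" "X \<in> cells C m"
  shows "fold (psi C (m + 1)) [1..<r] (degen C m i X) = degen C m i (fold (psi C m) [1..<r] X)"
  using assms
proof (induction r)
  case (Suc r)
  show ?case
  proof (cases "1 \<le> r")
    case True
    then show ?thesis
      using Suc psi_degen_less[of r i m "fold (psi C m) [1..<r] X"] fold_psi_closed[of r m X] by simp
  qed simp
qed simp

text \<open>\<open>\<Psi>\<^sub>r\<^sub>+\<^sub>1\<close> lowers the index of
  \<open>\<epsilon>\<^sub>r\<^sub>+\<^sub>1\<close> by one: its operations
  \<open>\<psi>\<^sub>1\<close> to \<open>\<psi>\<^sub>r\<^sub>-\<^sub>1\<close> commute with this
  degeneracy, and \<open>\<psi>\<^sub>r\<close> turns it into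
  \<open>\<epsilon>\<^sub>r\<close>.\<close>

lemma foldr_Psi_degen:
  assumes "1 \<le> r" "r \<le> m + 1" "X \<in> cells C m"
  shows "foldr (Psi C (m + 1)) [1..<r + 1] (degen C m r X) \<in> degen C m 1 ` cells C m"
  using assms
proof (induction r arbitrary: X rule: nat_induct_at_least)
  case base
  then show ?case by (simp add: Psi_def)
next
  case (Suc r)
  let ?Y = "fold (psi C m) [1..<r] X"
  have Y: "?Y \<in> cells C m" using Suc fold_psi_closed[of r m X] by simp
  have "Psi C (m + 1) (Suc r) (degen C m (Suc r) X) = degen C m r ?Y"
    using Suc fold_psi_degen[of r "Suc r" m X] psi_degen_Suc[of r "m + 1" ?Y] Y by (simp add: Psi_def)
  then show ?case using Suc.IH[OF _ Y] Suc.prems Suc.hyps by simp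
qed

text \<open>The hypothesis of (4). For \<open>n = 1\<close> it ranges over no direction, so the
  truncated \<open>n - 2\<close> does no harm.\<close>

definition thin_faces :: "nat \<Rightarrow> 'a \<Rightarrow> bool"
  where "thin_faces n A \<longleftrightarrow>
    (\<forall>j \<in> {1..n} - {1}. \<forall>\<alpha>. face C n j \<alpha> A \<in> degen C (n - 2) 1 ` cells C (n - 2))"

text \<open>The face in direction \<open>i + 1\<close> becomes degenerate in direction
  \<open>i\<close> when \<open>\<psi>\<^sub>i\<close> is applied; the operations with smaller index,
  applied afterwards, commute with taking this face and lower the degeneracy to direction 1.\<close>

lemma thin_faces_foldr_psi:
  assumes A: "A \<in> cells C n"
  shows "thin_faces n (foldr (psi C n) [1..<n] A)"
  unfolding thin_faces_def
proof (intro ballI allI)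
  fix k \<alpha> assume "k \<in> {1..n} - {1}"
  then obtain i where i: "k = i + 1" "1 \<le> i" "i < n" by (cases k) auto
  let ?Y = "foldr (psi C n) [i + 1..<n] A"
  let ?X = "face C (n - 1) i \<alpha> (face C n i \<alpha> ?Y)"
  have Y: "?Y \<in> cells C n" using foldr_psi_closed[of "i + 1" n n A] A by simp
  have X: "?X \<in> cells C (n - 2)"
    using face_closed[of i "n - 1" "face C n i \<alpha> ?Y"] face_closed[of i n ?Y] Y i by (simp add: numeral_2_eq_2)
  have "[1..<n] = [1..<i] @ i # [i + 1..<n]"
    using upt_add_eq_append[of 1 i "n - i"] upt_conv_Cons[of i n] i by simp
  then have "foldr (psi C n) [1..<n] A = foldr (psi C n) [1..<i] (psi C n i ?Y)" by simp
  then have "face C n k \<alpha> (foldr (psi C n) [1..<n] A) = foldr (psi C (n - 1)) [1..<i] (degen C (n - 2) i ?X)"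
    using face_foldr_psi[of i k n "psi C n i ?Y" \<alpha>] face_psi_Suc[of i n ?Y \<alpha>] psi_closed[of i n ?Y] Y i by simp
  also have "\<dots> = degen C (n - 2) 1 ?X"
    using foldr_psi_degen[of i "n - 2" ?X] X i by (simp add: numeral_2_eq_2 Suc_diff_Suc)
  finally show "face C n k \<alpha> (foldr (psi C n) [1..<n] A) \<in> degen C (n - 2) 1 ` cells C (n - 2)"
    using X by simp
qed

text \<open>In direction \<open>k = i + 1\<close> the degenerate face is created by
  \<open>\<psi>\<^sub>i\<close>, the last operation of \<open>\<Psi>\<^sub>k\<close>; the
  \<open>\<Psi>\<close> of smaller index then lower the degeneracy to direction 1.\<close>

lemma thin_faces_Phi:
  assumes A: "A \<in> cells C n"
  shows "thin_faces n (Phi C n A)"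
  unfolding thin_faces_def
proof (intro ballI allI)
  fix k \<alpha> assume "k \<in> {1..n} - {1}"
  then obtain i where i: "k = i + 1" "1 \<le> i" "i < n" by (cases k) auto
  let ?Y = "foldr (Psi C n) [k + 1..<n + 1] A"
  let ?Z = "fold (psi C n) [1..<i] ?Y"
  let ?X = "face C (n - 1) i \<alpha> (face C n i \<alpha> ?Z)"
  have Z: "?Z \<in> cells C n" using foldr_Psi_closed[of "n + 1" n A "k + 1"] fold_psi_closed[of i n ?Y] A i by simp
  have Y: "Psi C n k ?Y = psi C n i ?Z" using i by (simp add: Psi_def)
  have X: "?X \<in> cells C (n - 2)"
    using face_closed[of i "n - 1" "face C n i \<alpha> ?Z"] face_closed[of i n ?Z] Z i by (simp add: numeral_2_eq_2)
  have "[1..<n + 1] = [1..<k] @ k # [k + 1..<n + 1]"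
    using upt_add_eq_append[of 1 k "n + 1 - k"] upt_conv_Cons[of k "n + 1"] i by simp
  then have "Phi C n A = foldr (Psi C n) [1..<k] (psi C n i ?Z)" by (simp only: Phi_def foldr_append foldr.simps comp_apply Y)
  then have "face C n k \<alpha> (Phi C n A) = foldr (Psi C (n - 1)) [1..<k] (degen C (n - 2) i ?X)"
    using face_foldr_Psi[of k k n "psi C n i ?Z" \<alpha>] face_psi_Suc[of i n ?Z \<alpha>] psi_closed[of i n ?Z] Z i by simp
  then show "face C n k \<alpha> (Phi C n A) \<in> degen C (n - 2) 1 ` cells C (n - 2)"
    using foldr_Psi_degen[of i "n - 2" ?X] X i by (simp add: numeral_2_eq_2 Suc_diff_Suc)
qed

text \<open>Induction on the direction: for \<open>i + 1\<close>, the cell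
  \<open>psi C n i A\<close> satisfies the hypothesis in direction \<open>i\<close>, and its
  invertibility is transported back through the invertible faces of \<open>A\<close> in direction
  \<open>i\<close>.\<close>

lemma R_invertible_if_faces:
  assumes Q: "\<And>A. A \<in> cells C n \<Longrightarrow> R_invertible_faces n 1 A \<Longrightarrow> R_invertible C n 1 A"
    and i: "1 \<le> i" "i \<le> n" and A: "A \<in> cells C n" "R_invertible_faces n i A"
  shows "R_invertible C n i A"
  using i A
proof (induction i arbitrary: A rule: nat_induct_at_least)
  case base
  then show ?case using Q by simp
next
  case (Suc i)
  then have i: "1 \<le> i" "i < n" by auto
  have R: "R_invertible C (n - 1) ((i + 1) \<down> j) (face C n j \<alpha> A)" if "1 \<le> j" "j \<le> n" "j \<noteq> i + 1" for j \<alpha>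
    using Suc that by (auto simp: R_invertible_faces_def)
  have f: "face C n k \<alpha> A \<in> cells C (n - 1)" if "1 \<le> k" "k \<le> n" for k \<alpha>
    using face_closed Suc that by auto
  have "R_invertible_faces n i (psi C n i A)"
    unfolding R_invertible_faces_def
  proof (intro ballI allI)
    fix j \<alpha> assume j: "j \<in> {1..n} - {i}"
    show "R_invertible C (n - 1) (i \<down> j) (face C n j \<alpha> (psi C n i A))"
    proof (cases "j = i + 1")
      case True
      then show ?thesis
        using face_psi_Suc[OF i, of A \<alpha>] R_invertible_degen[of i "n - 1" "face C (n - 1) i \<alpha> (face C n i \<alpha> A)"]
          face_closed[of i "n - 1", OF _ _ f[of i \<alpha>]] Suc i j by (simp add: numeral_2_eq_2 idx_down_def)
    next
      case False
      \<comment> \<open>This face of \<open>psi C n i A\<close> is the folding of a face of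
        \<open>A\<close> that is invertible in the upper of the two folded directions; folding makes
        it invertible in the lower one.\<close>
      then have idx: "(i + 1) \<down> j = (i \<down> j) + 1" "1 \<le> i \<down> j" "i \<down> j < n - 1"
        using i j by (auto simp: idx_down_def)
      show ?thesis
        using face_psi_neq[OF i, of j A \<alpha>] R_invertible_psi_if_Suc[OF idx(2,3), of "face C n j \<alpha> A"]
          f[of j \<alpha>] R[of j \<alpha>, unfolded idx] Suc j False by simp
    qed
  qed
  then have "R_invertible C n i (psi C n i A)"
    using Suc psi_closed[OF i] by simp
  then have "R_invertible C n (i + 1) A"
    using R_invertible_Suc_if_psi[OF i, of A] R[of i] Suc i by (simp add: idx_down_def)
  then show ?case by simp
qed

end


section \<open>Invertible shells\<close>


abbreviation box_trunc :: "nat \<Rightarrow> 'a cubical \<Rightarrow> 'a box_cell cubical"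
  where "box_trunc N C \<equiv> box N (trunc N C)"

lemma trunc_simps [simp]: "face (trunc N C) = face C" "conn (trunc N C) = conn C"
  "degen (trunc N C) = degen C" "star (trunc N C) = star C" "cells (trunc N C) N = cells C N"
  by (simp_all add: trunc_def)

lemma shell_ops_trunc [simp]: "shells N (trunc N C) = shells N C" "degen_shell N (trunc N C) = degen_shell N C"
  "conn_shell N (trunc N C) = conn_shell N C" "star_shell N (trunc N C) = star_shell N C"
  by (simp_all add: shells_def degen_shell_def conn_shell_def star_shell_def fun_eq_iff)

text \<open>For a cell of top dimension, R- and T-invertibility involve only the dimensions
  \<open>N\<close> and \<open>N + 1\<close> of the shell category.\<close>

lemma box_trunc_simps:
  "cells (box_trunc N C) (Suc N) = Shell ` shells N C"
  "face (box_trunc N C) (Suc N) i \<alpha> (Shell S) = Cell (S (i, \<alpha>))"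
  "degen (box_trunc N C) N i (Cell X) = Shell (degen_shell N C i X)"
  "conn (box_trunc N C) N i \<alpha> (Cell X) = Shell (conn_shell N C i \<alpha> X)"
  "star (box_trunc N C) (Suc N) i (Shell S) (Shell T) = Shell (star_shell N C i S T)"
  by (simp_all add: box_def)

text \<open>The family underlying \<open>shell\<close>, without the constructor
  \<open>Shell\<close>.\<close>

definition boundary :: "'a cubical \<Rightarrow> nat \<Rightarrow> 'a \<Rightarrow> nat \<times> sign \<Rightarrow> 'a"
  where "boundary C n A = restrict (\<lambda>(i, \<alpha>). face C n i \<alpha> A) (shell_index n)"

lemma boundary_simps [simp]: "1 \<le> i \<Longrightarrow> i \<le> n \<Longrightarrow> boundary C n A (i, \<alpha>) = face C n i \<alpha> A"
  by (simp add: boundary_def)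

lemma shell_eq: "shell C n A = Shell (boundary C n A)"
  by (simp add: shell_def boundary_def)

lemma has_R_invertible_shell_iff:
  "has_R_invertible_shell C (Suc N) k A \<longleftrightarrow>
    (\<exists>T \<in> shells N C.
      boundary C (Suc N) A (k, Pos) = T (k, Neg) \<and>
      star_shell N C k (boundary C (Suc N) A) T = degen_shell N C k (boundary C (Suc N) A (k, Neg)) \<and>
      T (k, Pos) = boundary C (Suc N) A (k, Neg) \<and>
      star_shell N C k T (boundary C (Suc N) A) = degen_shell N C k (boundary C (Suc N) A (k, Pos)))"
  unfolding has_R_invertible_shell_def R_invertible_def composable_def shell_eq
  by (simp add: box_trunc_simps del: boundary_simps)

definition T_shell_equation :: "'a cubical \<Rightarrow> nat \<Rightarrow> nat \<Rightarrow> (nat \<times> sign \<Rightarrow> 'a) \<Rightarrow> (nat \<times> sign \<Rightarrow> 'a) \<Rightarrow> bool"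
  where "T_shell_equation C N i S T \<longleftrightarrow>
    star_shell N C (i + 1)
      (star_shell N C i (conn_shell N C i Pos (S (i + 1, Neg))) T)
      (star_shell N C i S (conn_shell N C i Neg (S (i, Pos))))
    = star_shell N C i (conn_shell N C i Neg (S (i, Neg))) (conn_shell N C i Pos (S (i + 1, Pos)))"

lemma has_T_invertible_shell_iff:
  "has_T_invertible_shell C (Suc N) i A \<longleftrightarrow>
    (\<exists>T \<in> shells N C. (\<forall>\<alpha>. boundary C (Suc N) A (i, \<alpha>) = T (i + 1, \<alpha>) \<and> boundary C (Suc N) A (i + 1, \<alpha>) = T (i, \<alpha>)) \<and>
      T_shell_equation C N i (boundary C (Suc N) A) T \<and> T_shell_equation C N i T (boundary C (Suc N) A))"
  unfolding has_T_invertible_shell_def T_invertible_def T_inverse_def T_equation_def T_shell_equation_def shell_eq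
  by (simp add: box_trunc_simps del: boundary_simps)

lemma shells_cell: "S \<in> shells N C \<Longrightarrow> 1 \<le> i \<Longrightarrow> i \<le> Suc N \<Longrightarrow> S (i, \<alpha>) \<in> cells C N"
  by (auto simp: shells_def)

lemma shells_face:
  "\<lbrakk>S \<in> shells N C; 1 \<le> i; i \<le> Suc N; 1 \<le> j; j \<le> Suc N; i \<noteq> j\<rbrakk>
    \<Longrightarrow> face C N (i \<down> j) \<alpha> (S (j, \<beta>)) = face C N (j \<down> i) \<beta> (S (i, \<alpha>))"
  by (auto simp: shells_def)

text \<open>The compatibility condition is symmetric in the two directions, so \<open>i < j\<close>
  suffices, where the renumbered indices are \<open>i\<close> and \<open>j - 1\<close>.\<close>

lemma shellsI:
  assumes "\<And>i \<alpha>. 1 \<le> i \<Longrightarrow> i \<le> Suc N \<Longrightarrow> F (i, \<alpha>) \<in> cells C N"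
    and face: "\<And>i j \<alpha> \<beta>. \<lbrakk>1 \<le> i; i < j; j \<le> Suc N\<rbrakk> \<Longrightarrow> face C N i \<alpha> (F (j, \<beta>)) = face C N (j - 1) \<beta> (F (i, \<alpha>))"
  shows "restrict F (shell_index (Suc N)) \<in> shells N C"
proof -
  have "face C N (i \<down> j) \<alpha> (F (j, \<beta>)) = face C N (j \<down> i) \<beta> (F (i, \<alpha>))"
    if "i \<in> {1..Suc N}" "j \<in> {1..Suc N}" "i \<noteq> j" for i j \<alpha> \<beta>
    using that face[of i j \<alpha> \<beta>] face[of j i \<beta> \<alpha>] by (cases "i < j") (auto simp: idx_down_def)
  then show ?thesis using assms(1) unfolding shells_def by auto
qed

context cubical_omega_category
begin

section \<open>From invertible shells to invertible faces\<close>

lemma boundary_in_shells: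
  assumes "A \<in> cells C (Suc N)"
  shows "boundary C (Suc N) A \<in> shells N C"
  unfolding boundary_def
  using face_closed[of _ "Suc N" A] face_face[of _ _ "Suc N" A] assms by (intro shellsI) auto

text \<open>Composition of shells in direction \<open>k\<close> acts entrywise in every direction
  \<open>j \<noteq> k\<close>, so the entry of the inverse shell at \<open>(j, \<alpha>)\<close> is
  inverse to that face of \<open>A\<close>.\<close>

lemma R_invertible_faces_if_shell:
  assumes A: "A \<in> cells C n" and k: "1 \<le> k" "k \<le> n" and "has_R_invertible_shell C n k A"
  shows "R_invertible_faces n k A"
  unfolding R_invertible_faces_def
proof (intro ballI allI)
  fix j \<alpha> assume j: "j \<in> {1..n} - {k}"
  obtain N where n: "n = Suc N" using k by (cases n) auto
  let ?S = "boundary C n A"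
  have S: "?S \<in> shells N C" using boundary_in_shells A n by simp
  obtain T where T: "T \<in> shells N C" and bd: "?S (k, Pos) = T (k, Neg)" "T (k, Pos) = ?S (k, Neg)"
    and eq: "star_shell N C k ?S T = degen_shell N C k (?S (k, Neg))" "star_shell N C k T ?S = degen_shell N C k (?S (k, Pos))"
    using assms(4) k unfolding n by (auto simp: has_R_invertible_shell_iff)
  have ff: "face C N (k \<down> j) \<beta> (U (j, \<alpha>)) = face C N (j \<down> k) \<alpha> (U (k, \<beta>))" if "U \<in> shells N C" for U \<beta>
    using shells_face[OF that, of k j] j k n by auto
  have "composable C N (k \<down> j) (?S (j, \<alpha>)) (T (j, \<alpha>))" "composable C N (k \<down> j) (T (j, \<alpha>)) (?S (j, \<alpha>))"
    unfolding composable_def using ff[OF S] ff[OF T] bd by simp_all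
  \<comment> \<open>Evaluating the shell equation at \<open>(j, \<alpha>)\<close> gives the face
    prescribed for a degenerate shell; \<open>ff\<close> rewrites it as a degeneracy on a face of
    the entry itself.\<close>
  moreover have "star C N (k \<down> j) (?S (j, \<alpha>)) (T (j, \<alpha>)) = degen C (N - 1) (k \<down> j) (face C N (k \<down> j) Neg (?S (j, \<alpha>)))"
    using fun_cong[OF eq(1), of "(j, \<alpha>)"] ff[OF S] j n by (simp add: star_shell_def degen_shell_def)
  moreover have "star C N (k \<down> j) (T (j, \<alpha>)) (?S (j, \<alpha>)) = degen C (N - 1) (k \<down> j) (face C N (k \<down> j) Pos (?S (j, \<alpha>)))"
    using fun_cong[OF eq(2), of "(j, \<alpha>)"] ff[OF S] j n by (simp add: star_shell_def degen_shell_def)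
  moreover have "T (j, \<alpha>) \<in> cells C N" using shells_cell[OF T] j n by simp
  ultimately have "R_invertible C N (k \<down> j) (?S (j, \<alpha>))" unfolding R_invertible_def by blast
  then show "R_invertible C (n - 1) (k \<down> j) (face C n j \<alpha> A)" using j n by simp
qed

section \<open>Shells of cells with degenerate transverse faces\<close>

lemma thin_facesE:
  assumes "thin_faces n A" "2 \<le> j" "j \<le> n"
  obtains X where "X \<in> cells C (n - 2)" "face C n j \<alpha> A = degen C (n - 2) 1 X"
proof -
  have "face C n j \<alpha> A \<in> degen C (n - 2) 1 ` cells C (n - 2)"
    using assms unfolding thin_faces_def by auto
  then show ?thesis using that by blast
qed

text \<open>The sign \<open>\<beta>\<close> is arbitrary because the two faces in direction 1 of a
  cell degenerate in that direction agree.\<close>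

lemma thin_faces_face:
  assumes A: "A \<in> cells C n" and "thin_faces n A" and j: "2 \<le> j" "j \<le> n"
  shows "face C n j \<alpha> A = degen C (n - 2) 1 (face C (n - 1) 1 \<beta> (face C n j \<alpha> A))"
proof -
  obtain X where X: "X \<in> cells C (n - 2)" "face C n j \<alpha> A = degen C (n - 2) 1 X"
    by (rule thin_facesE[OF assms(2) j])
  moreover have "n - 2 + 1 = n - 1" using j by simp
  ultimately show ?thesis using face_degen_eq[of 1 "n - 2" X \<beta>] by simp
qed

text \<open>The faces in direction 2 have the form \<open>\<epsilon>\<^sub>1 X\<close>, and
  \<open>\<Gamma>\<^sub>1 \<epsilon>\<^sub>1 X = \<epsilon>\<^sub>1 \<epsilon>\<^sub>1 X =
  \<epsilon>\<^sub>2 \<epsilon>\<^sub>1 X\<close>, so both connections in \<open>psi\<close> are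
  units. With \<open>T_invertible_iff_psi\<close>, \<open>T\<^sub>1\<close>- and
  \<open>R\<^sub>1\<close>-invertibility coincide for such cells.\<close>

lemma psi_thin:
  assumes A: "A \<in> cells C n" and "thin_faces n A" and n: "1 < n"
  shows "psi C n 1 A = A"
proof -
  have n': "n - 2 + 1 = n - 1" using n by simp
  have "conn C (n - 1) 1 \<beta> (face C n 2 \<alpha> A) = degen C (n - 1) 2 (face C n 2 \<alpha> A)" for \<alpha> \<beta>
  proof -
    obtain X where X: "X \<in> cells C (n - 2)" "face C n 2 \<alpha> A = degen C (n - 2) 1 X"
      by (rule thin_facesE[OF assms(2), of 2 \<alpha>]) (use n in auto)
    then show ?thesis
      using conn_degen_eq[of 1 "n - 2" X \<beta>, unfolded n'] degen_degen[of 1 1 "n - 2" X, unfolded n'] n by (simp add: numeral_2_eq_2)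
  qed
  then show ?thesis
    using star_unit_left[of 2 n A] star_unit_right[of 2 n A] A n unfolding psi_def by (simp add: numeral_2_eq_2)
qed

lemma R_invertible_shell_if_thin:
  assumes A: "A \<in> cells C n" and thin: "thin_faces n A" and n: "1 \<le> n"
  shows "has_R_invertible_shell C n 1 A"
proof -
  obtain N where N: "n = Suc N" using n by (cases n) auto
  \<comment> \<open>The inverse shell exchanges the two faces in direction 1 and keeps the others,
    which are degenerate in direction 1 and hence their own inverses.\<close>
  let ?F = "\<lambda>(j, \<alpha>). face C n j (if j = 1 then opp \<alpha> else \<alpha>) A"
  let ?T = "restrict ?F (shell_index (Suc N))"
  have ff: "face C N i \<alpha> (face C n j \<beta> A) = face C N (j - 1) \<beta> (face C n i \<alpha> A)" if "1 \<le> i" "i < j" "j \<le> n" for i j \<alpha> \<beta>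
    using face_face[of i j n A \<beta> \<alpha>] that A N by simp
  \<comment> \<open>Transverse faces have equal ends in direction 1, so exchanging signs there
    preserves compatibility of the family.\<close>
  have face1: "face C N 1 \<alpha> (face C n j \<beta> A) = face C N 1 \<gamma> (face C n j \<beta> A)" if j: "2 \<le> j" "j \<le> n" for j \<alpha> \<beta> \<gamma>
  proof -
    obtain X where X: "X \<in> cells C (n - 2)" "face C n j \<beta> A = degen C (n - 2) 1 X"
      by (rule thin_facesE[OF thin j])
    moreover have "n - 2 + 1 = N" using j N by simp
    ultimately show ?thesis using face_degen_eq[of 1 "n - 2" X] by simp
  qed
  have T: "?T \<in> shells N C"
  proof (rule shellsI)
    show "?F (i, \<alpha>) \<in> cells C N" if "1 \<le> i" "i \<le> Suc N" for i \<alpha>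
      using face_closed[of i n A] A N that by simp
    show "face C N i \<alpha> (?F (j, \<beta>)) = face C N (j - 1) \<beta> (?F (i, \<alpha>))" if "1 \<le> i" "i < j" "j \<le> Suc N" for i j \<alpha> \<beta>
      using ff[of i j \<alpha> \<beta>] ff[of i j "opp \<alpha>" \<beta>] face1[of j \<alpha> \<beta> "opp \<alpha>"] that N by (cases "i = 1") auto
  qed
  \<comment> \<open>The free sign \<open>\<beta>\<close> serves both inverse laws, whose right sides
    are degenerate on the negative and on the positive face of \<open>A\<close>.\<close>
  have compl: "star C N 1 (face C n j \<alpha> A) (face C n j \<alpha> A) = degen C (N - 1) 1 (face C N (j - 1) \<alpha> (face C n 1 \<beta> A))"
    if j: "2 \<le> j" "j \<le> n" for j \<alpha> \<beta>
  proof -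
    have a: "face C n j \<alpha> A = degen C (N - 1) 1 (face C N 1 \<gamma> (face C n j \<alpha> A))" for \<gamma>
      using thin_faces_face[OF A thin j, of \<alpha> \<gamma>] N by (simp add: numeral_2_eq_2)
    have "star C N 1 (degen C (N - 1) 1 (face C N 1 Neg (face C n j \<alpha> A))) (face C n j \<alpha> A) = face C n j \<alpha> A"
      using star_unit_left[of 1 N] face_closed[of j n A] A N j by simp
    then have "star C N 1 (face C n j \<alpha> A) (face C n j \<alpha> A) = face C n j \<alpha> A"
      by (simp only: a[of Neg, symmetric])
    also have "\<dots> = degen C (N - 1) 1 (face C N 1 \<beta> (face C n j \<alpha> A))" by (rule a)
    also have "face C N 1 \<beta> (face C n j \<alpha> A) = face C N (j - 1) \<alpha> (face C n 1 \<beta> A)"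
      using ff[of 1 j \<beta> \<alpha>] j by simp
    finally show ?thesis .
  qed
  have "star_shell N C 1 (boundary C n A) ?T = degen_shell N C 1 (face C n 1 Neg A)"
    "star_shell N C 1 ?T (boundary C n A) = degen_shell N C 1 (face C n 1 Pos A)"
    unfolding star_shell_def degen_shell_def
    by (rule restrict_ext; use N compl in \<open>auto simp: idx_down_def split: sign.split\<close>)+
  then show ?thesis using T N by (auto simp: has_R_invertible_shell_iff intro!: bexI[of _ ?T])
qed

text \<open>Outside directions \<open>i\<close> and \<open>i + 1\<close>, the entries of the shell
  equation are T-equations one dimension lower; in these two directions both sides agree because
  \<open>S\<close> and \<open>T\<close> have transposed faces.\<close>

lemma T_shell_equation_iff:
  assumes S: "S \<in> shells N C" and T: "T \<in> shells N C" and i: "1 \<le> i" "i \<le> N"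
    and swap: "\<And>\<alpha>. S (i, \<alpha>) = T (i + 1, \<alpha>)" "\<And>\<alpha>. S (i + 1, \<alpha>) = T (i, \<alpha>)"
  shows "T_shell_equation C N i S T \<longleftrightarrow>
    (\<forall>j \<in> {1..Suc N} - {i, i + 1}. \<forall>\<alpha>. T_equation C N (i \<down> j) (S (j, \<alpha>)) (T (j, \<alpha>)))"
proof -
  let ?L = "star_shell N C (i + 1)
      (star_shell N C i (conn_shell N C i Pos (S (i + 1, Neg))) T)
      (star_shell N C i S (conn_shell N C i Neg (S (i, Pos))))"
  let ?R = "star_shell N C i (conn_shell N C i Neg (S (i, Neg))) (conn_shell N C i Pos (S (i + 1, Pos)))"
  have cell: "S (j, \<alpha>) \<in> cells C N" if "1 \<le> j" "j \<le> Suc N" for j \<alpha> using shells_cell[OF S] that .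
  have corner: "face C N i \<alpha> (S (i + 1, \<beta>)) = face C N i \<beta> (S (i, \<alpha>))" for \<alpha> \<beta>
    using shells_face[OF S, of i "i + 1" \<alpha> \<beta>] i by (simp add: idx_down_def)
  have idx: "(i + 1) \<down> i = i" "i \<down> (i + 1) = i" by (simp_all add: idx_down_def)
  have other: "?L (j, \<alpha>) = ?R (j, \<alpha>) \<longleftrightarrow> T_equation C N (i \<down> j) (S (j, \<alpha>)) (T (j, \<alpha>))"
    if j: "j \<in> {1..Suc N} - {i, i + 1}" for j \<alpha>
  proof -
    have idx: "(i + 1) \<down> j = (i \<down> j) + 1" "j \<down> (i + 1) = j \<down> i" using j i by (auto simp: idx_down_def)
    have "face C N (i \<down> j) \<beta> (S (j, \<alpha>)) = face C N (j \<down> i) \<alpha> (S (i, \<beta>))"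
      "face C N ((i \<down> j) + 1) \<beta> (S (j, \<alpha>)) = face C N (j \<down> i) \<alpha> (S (i + 1, \<beta>))" for \<beta>
      using shells_face[OF S, of i j \<beta> \<alpha>] shells_face[OF S, of "i + 1" j \<beta> \<alpha>, unfolded idx] j i by auto
    then show ?thesis
      using j i unfolding T_equation_def star_shell_def conn_shell_def by (simp add: idx[simplified])
  qed
  \<comment> \<open>Every composite that occurs in these entries has a degenerate factor, and the
    corner conditions identify it as a unit.\<close>
  have edge: "?L (j, \<alpha>) = ?R (j, \<alpha>)" if "j \<in> {i, i + 1}" for j \<alpha>
  proof -
    have u: "star C N i (degen C (N - 1) i (face C N i Neg X)) X = X" "star C N i X (degen C (N - 1) i (face C N i Pos X)) = X"
      if "X \<in> cells C N" for X using star_unit_left star_unit_right i that by auto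
    have "?L (i, Neg) = ?R (i, Neg)"
      using i u[OF cell[of i Neg]] corner[of Neg Neg] by (simp add: star_shell_def conn_shell_def idx[simplified])
    moreover have "?L (i, Pos) = ?R (i, Pos)"
      using i u[OF cell[of "i + 1" Pos]] corner[of Pos Pos] swap(2)[of Pos] by (simp add: star_shell_def conn_shell_def idx[simplified])
    moreover have "?L (i + 1, Neg) = ?R (i + 1, Neg)"
      using i u[OF cell[of i Neg]] corner[of Neg Neg] corner[of Neg Pos] swap(1)[of Neg] by (simp add: star_shell_def conn_shell_def idx[simplified])
    moreover have "?L (i + 1, Pos) = ?R (i + 1, Pos)"
      using i u[OF cell[of "i + 1" Pos]] corner[of Pos Pos] corner[of Neg Pos] by (simp add: star_shell_def conn_shell_def idx[simplified])
    ultimately show ?thesis using that by (cases \<alpha>) auto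
  qed
  have "T_shell_equation C N i S T \<longleftrightarrow> (\<forall>j \<in> {1..Suc N}. \<forall>\<alpha>. ?L (j, \<alpha>) = ?R (j, \<alpha>))"
  proof
    assume *: "\<forall>j \<in> {1..Suc N}. \<forall>\<alpha>. ?L (j, \<alpha>) = ?R (j, \<alpha>)"
    have "?L x = ?R x" for x
    proof (cases "x \<in> shell_index (Suc N)")
      case True
      then show ?thesis using * by (cases x) blast
    next
      case False
      \<comment> \<open>Off the index set both families are \<open>undefined\<close>.\<close>
      then show ?thesis by (simp add: star_shell_def)
    qed
    then show "T_shell_equation C N i S T" unfolding T_shell_equation_def by (rule ext)
  qed (simp add: T_shell_equation_def)
  then show ?thesis using other edge by blast
qed

text \<open>Read off entrywise by \<open>T_shell_equation_iff\<close>; the compatibility of the two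
  shells supplies the transposed faces of the entries.\<close>

lemma T_invertible_face_if_shell:
  assumes A: "A \<in> cells C n" and i: "1 \<le> i" "i < n" and "has_T_invertible_shell C n i A"
    and j: "j \<in> {1..n} - {i, i + 1}"
  shows "T_invertible C (n - 1) (i \<down> j) (face C n j \<alpha> A)"
proof -
  obtain N where n: "n = Suc N" using i by (cases n) auto
  let ?S = "boundary C n A"
  have S: "?S \<in> shells N C" using boundary_in_shells A n by simp
  obtain T where T: "T \<in> shells N C" and swap: "\<And>\<alpha>. ?S (i, \<alpha>) = T (i + 1, \<alpha>)" "\<And>\<alpha>. ?S (i + 1, \<alpha>) = T (i, \<alpha>)"
    and eq: "T_shell_equation C N i ?S T" "T_shell_equation C N i T ?S"
    using assms(4) unfolding n has_T_invertible_shell_iff by auto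
  have idx: "(i + 1) \<down> j = (i \<down> j) + 1" "j \<down> (i + 1) = j \<down> i" using j i by (auto simp: idx_down_def)
  have ff: "face C N (i \<down> j) \<beta> (U (j, \<alpha>)) = face C N (j \<down> i) \<alpha> (U (i, \<beta>))"
      "face C N ((i \<down> j) + 1) \<beta> (U (j, \<alpha>)) = face C N (j \<down> i) \<alpha> (U (i + 1, \<beta>))" if U: "U \<in> shells N C" for \<beta> U
      using shells_face[OF U, of i j \<beta> \<alpha>] shells_face[OF U, of "i + 1" j \<beta> \<alpha>, unfolded idx] j i n by auto
  have "T_equation C N (i \<down> j) (?S (j, \<alpha>)) (T (j, \<alpha>))" "T_equation C N (i \<down> j) (T (j, \<alpha>)) (?S (j, \<alpha>))"
    using T_shell_equation_iff[OF S T _ _ swap] T_shell_equation_iff[OF T S _ _ swap(2,1)[symmetric]] eq i j n by auto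
  then have "T_inverse C N (i \<down> j) (?S (j, \<alpha>)) (T (j, \<alpha>))"
    unfolding T_inverse_def ff[OF S] ff[OF T] swap by simp
  moreover have "T (j, \<alpha>) \<in> cells C N" using shells_cell[OF T] j n by simp
  ultimately show ?thesis using j n by (auto simp: T_invertible_def)
qed

lemma T_invertible_shell_if_thin:
  assumes A: "A \<in> cells C n" and thin: "thin_faces n A" and n: "1 < n"
  shows "has_T_invertible_shell C n 1 A"
proof -
  obtain N where N: "n = Suc N" using n by (cases n) auto
  then have N1: "1 \<le> N" using n by simp
  let ?D = "\<lambda>i \<alpha>. face C n i \<alpha> A"
  let ?X = "\<lambda>j \<alpha>. face C N 1 Neg (?D j \<alpha>)"
  \<comment> \<open>The T-inverse shell is the transposed one: the faces in directions 1 and 2 are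
    exchanged, and every other face \<open>\<epsilon>\<^sub>1 X\<close> is replaced by
    \<open>\<epsilon>\<^sub>2 X\<close>, where \<open>?X\<close> recovers \<open>X\<close> as a
    face.\<close>
  let ?F = "\<lambda>(j, \<alpha>). if j = 1 then ?D 2 \<alpha> else if j = 2 then ?D 1 \<alpha> else degen C (N - 1) 2 (?X j \<alpha>)"
  let ?T = "restrict ?F (shell_index (Suc N))"
  have f: "?D j \<alpha> \<in> cells C N" if "1 \<le> j" "j \<le> n" for j \<alpha>
    using face_closed[of j n A \<alpha>] that A N by simp
  have X: "?X j \<alpha> \<in> cells C (N - 1)" if "1 \<le> j" "j \<le> n" for j \<alpha>
    using face_closed[of 1 N "?D j \<alpha>" Neg] f[OF that] N1 by simp
  have ff: "face C N i \<alpha> (?D j \<beta>) = face C N (j - 1) \<beta> (?D i \<alpha>)" if "1 \<le> i" "i < j" "j \<le> n" for i j \<alpha> \<beta>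
    using face_face[of i j n A \<beta> \<alpha>] that A N by simp
  have ffN: "face C (N - 1) 1 Neg (face C N k \<gamma> Z) = face C (N - 1) (k - 1) \<gamma> (face C N 1 Neg Z)"
    if "2 \<le> k" "k \<le> N" "Z \<in> cells C N" for k \<gamma> Z
    using face_face[of 1 k N Z \<gamma> Neg] that by simp
  have XX: "face C (N - 1) (i - 1) \<alpha> (?X j \<beta>) = face C (N - 1) (j - 2) \<beta> (?X i \<alpha>)"
    if ij: "2 \<le> i" "i < j" "j \<le> n" for i j \<alpha> \<beta>
  proof -
    have "face C (N - 1) (i - 1) \<alpha> (?X j \<beta>) = face C (N - 1) 1 Neg (face C N i \<alpha> (?D j \<beta>))"
      using ffN[of i "?D j \<beta>" \<alpha>] f[of j \<beta>] ij N by simp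
    also have "face C N i \<alpha> (?D j \<beta>) = face C N (j - 1) \<beta> (?D i \<alpha>)"
      using ff ij by simp
    also have "face C (N - 1) 1 Neg (face C N (j - 1) \<beta> (?D i \<alpha>)) = face C (N - 1) (j - 1 - 1) \<beta> (?X i \<alpha>)"
      using ffN[of "j - 1" "?D i \<alpha>" \<beta>] f[of i \<alpha>] ij N by simp
    finally show ?thesis by (simp add: numeral_2_eq_2)
  qed
  have thin': "?D j \<alpha> = degen C (N - 1) 1 (face C N 1 \<gamma> (?D j \<alpha>))" if "2 \<le> j" "j \<le> n" for j \<alpha> \<gamma>
    using thin_faces_face[OF A thin that, of \<alpha> \<gamma>] N by (simp add: numeral_2_eq_2)
  have face1: "face C N 1 \<gamma> (?D j \<alpha>) = ?X j \<alpha>" if "2 \<le> j" "j \<le> n" for j \<alpha> \<gamma>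
    using arg_cong[OF thin'[OF that, of \<alpha> Neg], of "face C N 1 \<gamma>"]
      face_degen_eq[of 1 "N - 1" "?X j \<alpha>" \<gamma>] X[of j \<alpha>] that N1 by simp
  have fd: "face C N k \<gamma> (degen C (N - 1) l Z) = degen C (N - 1 - 1) (l \<down> k) (face C (N - 1) (k \<down> l) \<gamma> Z)"
    if "1 \<le> k" "k \<le> N" "1 \<le> l" "l \<le> N" "k \<noteq> l" "Z \<in> cells C (N - 1)" for k l \<gamma> Z
    using face_degen_neq[of k "N - 1" l Z \<gamma>] that by simp
  have T: "?T \<in> shells N C"
  proof (rule shellsI)
    show "?F (i, \<alpha>) \<in> cells C N" if "1 \<le> i" "i \<le> Suc N" for i \<alpha>
      using that f[of 1 \<alpha>] f[of 2 \<alpha>] degen_closed[of 2 "N - 1", OF _ _ X[of i \<alpha>]] n N N1 by auto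
    show "face C N i \<alpha> (?F (j, \<beta>)) = face C N (j - 1) \<beta> (?F (i, \<alpha>))" if ij: "1 \<le> i" "i < j" "j \<le> Suc N" for i j \<alpha> \<beta>
    proof -
      \<comment> \<open>Compatibility depends on whether both, one or none of the directions are
        among the two that were exchanged.\<close>
      consider "i = 1" "j = 2" | "i = 1" "3 \<le> j" | "i = 2" "3 \<le> j" | "3 \<le> i" using ij by linarith
      then show ?thesis
      proof cases
        case 1
        then show ?thesis using ff[of 1 2 \<beta> \<alpha>] n by simp
      next
        case 2
        have "face C N 1 \<alpha> (degen C (N - 1) 2 (?X j \<beta>)) = degen C (N - 1 - 1) 1 (face C (N - 1) 1 \<alpha> (?X j \<beta>))"
          using fd[of 1 2 "?X j \<beta>" \<alpha>] X[of j \<beta>] ij 2 N by (simp add: idx_down_def)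
        also have "\<dots> = degen C (N - 1 - 1) 1 (face C (N - 1) (j - 2) \<beta> (?X 2 \<alpha>))"
          using XX[of 2 j \<alpha> \<beta>] ij 2 N by simp
        also have "\<dots> = face C N (j - 1) \<beta> (degen C (N - 1) 1 (?X 2 \<alpha>))"
          using fd[of "j - 1" 1 "?X 2 \<alpha>" \<beta>] X[of 2 \<alpha>] ij 2 N by (simp add: idx_down_def numeral_2_eq_2)
        also have "degen C (N - 1) 1 (?X 2 \<alpha>) = ?D 2 \<alpha>" using thin'[of 2 \<alpha> Neg] n by simp
        finally show ?thesis using 2 by simp
      next
        case 3
        have "face C N 2 \<alpha> (degen C (N - 1) 2 (?X j \<beta>)) = ?X j \<beta>"
          using face_degen_eq[of 2 "N - 1" "?X j \<beta>" \<alpha>] X[of j \<beta>] ij 3 N by simp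
        also have "\<dots> = face C N (j - 1) \<beta> (?D 1 \<alpha>)"
          using face1[of j \<alpha> \<beta>] ff[of 1 j \<alpha> \<beta>] ij 3 N by simp
        finally show ?thesis using 3 by simp
      next
        case 4
        have "face C N i \<alpha> (degen C (N - 1) 2 (?X j \<beta>)) = degen C (N - 1 - 1) 2 (face C (N - 1) (i - 1) \<alpha> (?X j \<beta>))"
          using fd[of i 2 "?X j \<beta>" \<alpha>] X[of j \<beta>] ij 4 N by (simp add: idx_down_def)
        also have "\<dots> = degen C (N - 1 - 1) 2 (face C (N - 1) (j - 2) \<beta> (?X i \<alpha>))"
          using XX[of i j \<alpha> \<beta>] ij 4 N by simp
        also have "\<dots> = face C N (j - 1) \<beta> (degen C (N - 1) 2 (?X i \<alpha>))"
        proof -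
          have "2 \<down> (j - 1) = 2" "(j - 1) \<down> 2 = j - 2" using ij 4 by (auto simp: idx_down_def)
          then show ?thesis using fd[of "j - 1" 2 "?X i \<alpha>" \<beta>] X[of i \<alpha>] ij 4 N by simp
        qed
        finally show ?thesis using 4 ij by simp
      qed
    qed
  qed
  let ?S = "boundary C n A"
  have S: "?S \<in> shells N C" using boundary_in_shells A N by simp
  have swap: "?S (1, \<alpha>) = ?T (1 + 1, \<alpha>)" "?S (1 + 1, \<alpha>) = ?T (1, \<alpha>)" for \<alpha>
    using N N1 by (simp_all add: numeral_2_eq_2)
  have "T_equation C N (1 \<down> j) (?S (j, \<alpha>)) (?T (j, \<alpha>)) \<and> T_equation C N (1 \<down> j) (?T (j, \<alpha>)) (?S (j, \<alpha>))"
    if "j \<in> {1..Suc N} - {1, 1 + 1}" for j \<alpha>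
  proof -
    \<comment> \<open>In the remaining directions the entries are
      \<open>\<epsilon>\<^sub>1 X\<close> and \<open>\<epsilon>\<^sub>2 X\<close>, to which
      \<open>T_equation_degen\<close> applies.\<close>
    have j: "3 \<le> j" "j \<le> n" using that N by auto
    then have "?S (j, \<alpha>) = degen C (N - 1) 1 (?X j \<alpha>)" "?T (j, \<alpha>) = degen C (N - 1) (1 + 1) (?X j \<alpha>)"
      using thin'[of j \<alpha> Neg] N by (simp_all add: numeral_2_eq_2)
    moreover have "1 \<down> j = 1" using j by (simp add: idx_down_def)
    ultimately show ?thesis using T_equation_degen[of 1 N "?X j \<alpha>"] X[of j \<alpha>] j N by simp
  qed
  then have "T_shell_equation C N 1 ?S ?T" "T_shell_equation C N 1 ?T ?S"
    unfolding T_shell_equation_iff[OF S T order_refl N1 swap]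
      T_shell_equation_iff[OF T S order_refl N1 swap(2,1)[symmetric]]
    by blast+
  then show ?thesis using T swap unfolding N has_T_invertible_shell_iff by blast
qed

end

theorem proposition4p1p2:
  fixes C :: "'a cubical" and n :: nat
  assumes "cubical_omega_category C" and "n > 0"
  shows
    "let P1 = (\<forall>A \<in> cells C n. invertible C n A);
         P2 = (\<forall>i \<in> {1..n}. \<forall>A \<in> cells C n.
                 has_R_invertible_shell C n i A \<longrightarrow> R_invertible C n i A);
         P3 = (\<forall>A \<in> cells C n. has_R_invertible_shell C n 1 A \<longrightarrow> R_invertible C n 1 A);
         P4 = (\<forall>A \<in> cells C n.
                 (\<forall>j \<in> {1..n} - {1}. \<forall>\<alpha>. face C n j \<alpha> A \<in> degen C (n - 2) 1 ` cells C (n - 2))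
                 \<longrightarrow> R_invertible C n 1 A);
         P5 = (\<forall>A \<in> Phi C n ` cells C n. R_invertible C n 1 A);
         P6 = (\<forall>i \<in> {1..<n}. \<forall>A \<in> cells C n.
                 has_T_invertible_shell C n i A \<longrightarrow> T_invertible C n i A);
         P7 = (\<forall>A \<in> cells C n. has_T_invertible_shell C n 1 A \<longrightarrow> T_invertible C n 1 A)
     in (P1 \<longleftrightarrow> P2) \<and> (P1 \<longleftrightarrow> P3) \<and> (P1 \<longleftrightarrow> P4) \<and> (P1 \<longleftrightarrow> P5) \<and>
        (n > 1 \<longrightarrow> (P1 \<longleftrightarrow> P6) \<and> (P1 \<longleftrightarrow> P7))"
proof -
  interpret cubical_omega_category C by fact
  define P1 where "P1 \<longleftrightarrow> (\<forall>A \<in> cells C n. invertible C n A)"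
  define P2 where "P2 \<longleftrightarrow> (\<forall>i \<in> {1..n}. \<forall>A \<in> cells C n. has_R_invertible_shell C n i A \<longrightarrow> R_invertible C n i A)"
  define P3 where "P3 \<longleftrightarrow> (\<forall>A \<in> cells C n. has_R_invertible_shell C n 1 A \<longrightarrow> R_invertible C n 1 A)"
  define P4 where "P4 \<longleftrightarrow> (\<forall>A \<in> cells C n. thin_faces n A \<longrightarrow> R_invertible C n 1 A)"
  define P5 where "P5 \<longleftrightarrow> (\<forall>A \<in> Phi C n ` cells C n. R_invertible C n 1 A)"
  define P6 where "P6 \<longleftrightarrow> (\<forall>i \<in> {1..<n}. \<forall>A \<in> cells C n. has_T_invertible_shell C n i A \<longrightarrow> T_invertible C n i A)"
  define P7 where "P7 \<longleftrightarrow> (\<forall>A \<in> cells C n. has_T_invertible_shell C n 1 A \<longrightarrow> T_invertible C n 1 A)"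
  \<comment> \<open>\<open>Q\<close> is the hub: (3) with the invertible shell replaced by
    invertible faces. The implications run from \<open>P1\<close> and \<open>P5\<close> to
    \<open>Q\<close>, then through \<open>P2\<close>, \<open>P3\<close>, \<open>P4\<close> back to
    \<open>P1\<close> and \<open>P5\<close>; for \<open>n > 1\<close> a second branch leads from
    \<open>Q\<close> through \<open>P6\<close> and \<open>P7\<close> to \<open>P4\<close>.\<close>
  define Q where "Q \<longleftrightarrow> (\<forall>A \<in> cells C n. R_invertible_faces n 1 A \<longrightarrow> R_invertible C n 1 A)"
  have n: "1 \<le> n" using assms by simp
  have "P1 \<Longrightarrow> Q"
    using reflects_foldr[of "[1..<n]" n "psi C n"] reflects_psi[of _ n]
    unfolding P1_def Q_def invertible_def reflects_inv_def by auto
  moreover have "P5 \<Longrightarrow> Q"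
    using reflects_Phi[of n] unfolding P5_def Q_def reflects_inv_def by blast
  moreover have QR: "R_invertible C n i A" if Q "1 \<le> i" "i \<le> n" "A \<in> cells C n" "R_invertible_faces n i A" for i A
    using R_invertible_if_faces that unfolding Q_def by blast
  then have "Q \<Longrightarrow> P2"
    using R_invertible_faces_if_shell unfolding P2_def by auto
  moreover have "P2 \<Longrightarrow> P3" using n unfolding P2_def P3_def by auto
  moreover have "P3 \<Longrightarrow> P4"
    using R_invertible_shell_if_thin n unfolding P3_def P4_def by blast
  moreover have "P4 \<Longrightarrow> P1"
    using thin_faces_foldr_psi foldr_psi_closed[of 1 n n] unfolding P4_def P1_def invertible_def by auto
  moreover have "P4 \<Longrightarrow> P5"
    using thin_faces_Phi foldr_Psi_closed[of "n + 1" n _ 1] unfolding P4_def P5_def Phi_def by auto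
  \<comment> \<open>\<open>T\<^sub>i\<close>-invertibility of \<open>A\<close> is
    \<open>R\<^sub>i\<close>-invertibility of \<open>psi C n i A\<close>, so \<open>Q\<close>,
    extended to direction \<open>i\<close> by \<open>QR\<close>, applies once the transverse faces
    of that folded cell are invertible.\<close>
  moreover have "P6" if Q "1 < n"
    unfolding P6_def
  proof (intro ballI impI)
    fix i A assume i: "i \<in> {1..<n}" and A: "A \<in> cells C n" and sh: "has_T_invertible_shell C n i A"
    have i': "1 \<le> i" "i < n" using i by auto
    have "R_invertible_faces n i (psi C n i A)"
      unfolding R_invertible_faces_def
    proof (intro ballI allI)
      fix j \<alpha> assume j: "j \<in> {1..n} - {i}"
      show "R_invertible C (n - 1) (i \<down> j) (face C n j \<alpha> (psi C n i A))"
      proof (cases "j = i + 1")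
        case True
        have "face C (n - 1) i \<alpha> (face C n i \<alpha> A) \<in> cells C (n - 2)"
          using face_closed[of i "n - 1" "face C n i \<alpha> A" \<alpha>] face_closed[of i n A \<alpha>] A i'
          by (simp add: numeral_2_eq_2)
        then show ?thesis
          using face_psi_Suc[OF i', of A \<alpha>] R_invertible_degen[of i "n - 1"] A i' True
          by (simp add: numeral_2_eq_2 idx_down_def)
      next
        case False
        \<comment> \<open>The shell makes this face of \<open>A\<close> T-invertible, so its
          folding, which is the face of \<open>psi C n i A\<close>, is R-invertible.\<close>
        have idx: "1 \<le> i \<down> j" "i \<down> j < n - 1" using i' j False by (auto simp: idx_down_def)
        then show ?thesis
          using face_psi_neq[OF i', of j A \<alpha>] T_invertible_iff_psi[OF idx, of "face C n j \<alpha> A"]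
            T_invertible_face_if_shell[OF A i' sh, of j \<alpha>] face_closed[of j n A \<alpha>] A j False by simp
      qed
    qed
    then show "T_invertible C n i A"
      using QR[OF that(1), of i "psi C n i A"] psi_closed[OF i' A] T_invertible_iff_psi[OF i' A] i' by simp
  qed
  moreover have "P6 \<Longrightarrow> 1 < n \<Longrightarrow> P7" unfolding P6_def P7_def by auto
  \<comment> \<open>\<open>psi C n 1\<close> fixes these cells, so their
    \<open>T\<^sub>1\<close>-invertibility is already
    \<open>R\<^sub>1\<close>-invertibility.\<close>
  moreover have "P4" if P7 "1 < n"
    using that T_invertible_shell_if_thin T_invertible_iff_psi[of 1 n] psi_thin
    unfolding P4_def P7_def by force
  ultimately have "(P1 \<longleftrightarrow> P2) \<and> (P1 \<longleftrightarrow> P3) \<and> (P1 \<longleftrightarrow> P4) \<and> (P1 \<longleftrightarrow> P5) \<and>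
        (n > 1 \<longrightarrow> (P1 \<longleftrightarrow> P6) \<and> (P1 \<longleftrightarrow> P7))"
    by blast
  then show ?thesis
    unfolding Let_def P1_def P2_def P3_def P4_def P5_def P6_def P7_def thin_faces_def .
qed

end
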